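(* Let $S$ be a discrete semigroup, let $E$ be a Banach space, and let $\pi$ be a JdLG-admissible representation of $S$ on $E$. Let $Q$ be the projection of $E$ onto $E_r$ whose kernel is $E_{\mathrm{aws}}$, and for $p\in\beta S$ let $\pi_p:=p\text{-}\lim_s\pi_s$ (limit in the weak operator topology). (i) If $p\in\overline{K(\beta S)}$ is an idempotent, then $\pi_p=Q$. (ii) If $S$ is bi-amenable, then for each essential idempotent $p\in\mathcal{D}^*(S)$ we have $\pi_p=Q$. (iii) If $S$ is cancellative and left reversible, and $p\in\beta S$ is of the form $q^{-1}q$ for some $q\in\overline{K(\beta S)}$, then $\pi_p=Q$. (iv) If $S$ is cancellative and bi-amenable, and $p\in\beta S$ is of the form $q^{-1}q$ for some $q\in\mathcal{D}^*(S)$, then $\pi_p=Q$.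
   Context: Banach spaces are complex. $\mathcal{L}(E)$ is the space of bounded linear operators on $E$; $\operatorname{cl}_\sigma$ denotes closure in the weak operator topology. A representation $\pi$ of a discrete semigroup $S$ on $E$ is a semigroup homomorphism $\pi:S\to\mathcal{L}(E)$, $s\mapsto\pi_s$ (with $\pi_e=\mathrm{Id}$ if $S$ has an identity $e$). It is JdLG-admissible if $\pi(S)$ is relatively compact in the weak operator topology and $\mathscr{S}:=\operatorname{cl}_\sigma(\pi(S))$ contains a unique minimal idempotent (an idempotent in the smallest two-sided ideal of $\mathscr{S}$). Equivalently, $\mathscr{S}$ is compact in the weak operator topology and $E_r=\{\xi:\forall u\in\mathscr{S}\ \exists v\in\mathscr{S},\ vu\xi=\xi\}$, $E_{\mathrm{aws}}=\{\xi:u\xi=0\text{ for some }u\in\mathscr{S}\}$ are closed $\mathscr{S}$-invariant subspaces with $E=E_r\oplus E_{\mathrm{aws}}$. $\beta S$ is the space of ultrafilters on $S$ (Stone–Čech compactification), with the extension of the semigroup operation making it a compact right topological semigroup (each $q\mapsto qp$ is continuous): $A\in qp$ iff $\{s\in S:s^{-1}A\in p\}\in q$, where $s^{-1}A=\{t:st\in A\}$. $K(\beta S)$ is its smallest two-sided ideal. For $f:S\to X$, $p\text{-}\lim_sf(s)=x$ means $\{s:f(s)\in U\}\in p$ for every open neighborhood $U$ of $x$. $S$ is left-amenable (bi-amenable) if there is a left-invariant (left- and right-invariant) mean on $\ell^\infty(S)$, i.e. a positive linear functional $m$ of norm $1$ with $m(t\mapsto f(st))=m(f)$ (and also $m(t\mapsto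 f(ts))=m(f)$) for all $s,f$. For left-amenable $S$, $d^*(A)=\sup\{m(\mathbb{1}_A):m\text{ a left-invariant mean on }\ell^\infty(S)\}$ and $\mathcal{D}^*(S)=\{p\in\beta S:d^*(A)>0\ \forall A\in p\}$. An essential idempotent is an idempotent of $\beta S$ lying in $\mathcal{D}^*(S)$. $S$ is cancellative if $ab=ac$ or $ba=ca$ implies $b=c$; left reversible if $rS\cap sS\ne\emptyset$ for all $r,s\in S$ (every left-amenable semigroup is left reversible). A cancellative left reversible semigroup embeds in a group $G$ of right quotients: $S\subseteq G$ and each $g\in G$ is $st^{-1}$ with $s,t\in S$. One identifies $\beta S$ with $\{p\in\beta G:S\in p\}$. For $p\in\beta G$, $p^{-1}=\{A^{-1}:A\in p\}$, and $q^{-1}q$ denotes the product in $\beta G$, i.e. for $A\subseteq G$, $A\in q^{-1}q$ iff $\{g\in G:g^{-1}A\in q\}\in q^{-1}$, where $g^{-1}A=\{h\in G:gh\in A\}$. *)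

theory Defs
  imports "HOL-Analysis.Analysis"
begin

section \<open>Complex Banach spaces and the weak operator topology\<close>

class complex_banach = banach +
  fixes scaleC :: "complex \<Rightarrow> 'a \<Rightarrow> 'a"  (infixr \<open>*\<^sub>C\<close> 75)
  assumes scaleC_add_right: "a *\<^sub>C (x + y) = a *\<^sub>C x + a *\<^sub>C y"
    and scaleC_add_left: "(a + b) *\<^sub>C x = a *\<^sub>C x + b *\<^sub>C x"
    and scaleC_scaleC: "a *\<^sub>C (b *\<^sub>C x) = (a * b) *\<^sub>C x"
    and scaleC_one: "1 *\<^sub>C x = x"
    and scaleC_of_real: "complex_of_real r *\<^sub>C x = r *\<^sub>R x"
    and norm_scaleC: "norm (a *\<^sub>C x) = cmod a * norm x"

instantiation complex :: complex_banach
begin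

definition scaleC_complex :: "complex \<Rightarrow> complex \<Rightarrow> complex"
  where "scaleC_complex a x = a * x"

instance
  by standard (simp_all add: scaleC_complex_def algebra_simps norm_mult scaleR_conv_of_real)

end

definition bounded_clinear :: "('a::complex_banach \<Rightarrow> 'b::complex_banach) \<Rightarrow> bool"
  where "bounded_clinear T \<longleftrightarrow> bounded_linear T \<and> (\<forall>c x. T (c *\<^sub>C x) = c *\<^sub>C T x)"

definition bounded_operators :: "('e::complex_banach \<Rightarrow> 'e) set"
  where "bounded_operators = {T. bounded_clinear T}"

text \<open>The carrier of this topology is the set of all bounded operators (take \<open>U = UNIV\<close>).\<close>

definition weak_operator_topology :: "('e::complex_banach \<Rightarrow> 'e) topology"
  where "weak_operator_topology = topology_generated_by
    {{T \<in> bounded_operators. \<phi> (T \<xi>) \<in> U} | (\<phi> :: 'e \<Rightarrow> complex) \<xi> U.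
       bounded_clinear \<phi> \<and> open U}"

lemma topspace_weak_operator_topology:
  "topspace weak_operator_topology = (bounded_operators :: ('e::complex_banach \<Rightarrow> 'e) set)"
proof -
  have z: "bounded_clinear (\<lambda>_::'e. 0::complex)"
    by (simp add: bounded_clinear_def scaleC_complex_def)
  have "bounded_operators \<in> {{T \<in> bounded_operators. \<phi> (T \<xi>) \<in> U} | (\<phi> :: 'e \<Rightarrow> complex) \<xi> U.
       bounded_clinear \<phi> \<and> open U}"
    using z by (intro CollectI exI[of _ "\<lambda>_. 0"] exI[of _ 0] exI[of _ UNIV]) auto
  then show ?thesis
    unfolding weak_operator_topology_def topology_generated_by_topspace by blast
qed

section \<open>Ideals\<close>

definition two_sided_ideal :: "'a set \<Rightarrow> ('a \<Rightarrow> 'a \<Rightarrow> 'a) \<Rightarrow> 'a set \<Rightarrow> bool"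
  where "two_sided_ideal T f I \<longleftrightarrow>
    I \<noteq> {} \<and> I \<subseteq> T \<and> (\<forall>a\<in>T. \<forall>x\<in>I. f a x \<in> I \<and> f x a \<in> I)"

text \<open>If the semigroup \<open>(T, f)\<close> has a smallest two-sided ideal, then this is it; otherwise the
  intersection is empty, since a nonempty intersection of ideals is an ideal.\<close>

definition smallest_ideal :: "'a set \<Rightarrow> ('a \<Rightarrow> 'a \<Rightarrow> 'a) \<Rightarrow> 'a set"
  where "smallest_ideal T f = \<Inter> {I. two_sided_ideal T f I}"

section \<open>JdLG-admissible representations\<close>

definition representation :: "('s::semigroup_mult \<Rightarrow> 'e::complex_banach \<Rightarrow> 'e) \<Rightarrow> bool"
  where "representation \<pi> \<longleftrightarrow>
    (\<forall>s. \<pi> s \<in> bounded_operators) \<and>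
    (\<forall>s t. \<pi> (s * t) = \<pi> s \<circ> \<pi> t) \<and>
    (\<forall>e. (\<forall>s. e * s = s \<and> s * e = s) \<longrightarrow> \<pi> e = id)"

definition wot_hull :: "('s \<Rightarrow> 'e::complex_banach \<Rightarrow> 'e) \<Rightarrow> ('e \<Rightarrow> 'e) set"
  where "wot_hull \<pi> = weak_operator_topology closure_of range \<pi>"

definition JdLG_admissible :: "('s::semigroup_mult \<Rightarrow> 'e::complex_banach \<Rightarrow> 'e) \<Rightarrow> bool"
  where "JdLG_admissible \<pi> \<longleftrightarrow>
    representation \<pi> \<and>
    compactin weak_operator_topology (wot_hull \<pi>) \<and>
    (\<exists>!u. u \<in> smallest_ideal (wot_hull \<pi>) (\<circ>) \<and> u \<circ> u = u)"

definition E_r :: "('s \<Rightarrow> 'e::complex_banach \<Rightarrow> 'e) \<Rightarrow> 'e set"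
  where "E_r \<pi> = {\<xi>. \<forall>u\<in>wot_hull \<pi>. \<exists>v\<in>wot_hull \<pi>. v (u \<xi>) = \<xi>}"

definition E_aws :: "('s \<Rightarrow> 'e::complex_banach \<Rightarrow> 'e) \<Rightarrow> 'e set"
  where "E_aws \<pi> = {\<xi>. \<exists>u\<in>wot_hull \<pi>. u \<xi> = 0}"

definition is_JdLG_projection ::
    "('s \<Rightarrow> 'e::complex_banach \<Rightarrow> 'e) \<Rightarrow> ('e \<Rightarrow> 'e) \<Rightarrow> bool"
  where "is_JdLG_projection \<pi> Q \<longleftrightarrow>
    Q \<in> bounded_operators \<and> Q \<circ> Q = Q \<and> range Q = E_r \<pi> \<and> {\<xi>. Q \<xi> = 0} = E_aws \<pi>"

lemma is_JdLG_projection_unique: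
  assumes "is_JdLG_projection \<pi> P" and "is_JdLG_projection \<pi> Q"
  shows "P = Q"
proof
  fix x
  have lin: "linear P" "linear Q"
    using assms by (auto simp: is_JdLG_projection_def bounded_operators_def bounded_clinear_def
        bounded_linear.linear)
  have PP: "P (P y) = P y" and QQ: "Q (Q y) = Q y" for y
    using assms unfolding is_JdLG_projection_def by (metis comp_apply)+
  have "P x \<in> range Q"
    using assms unfolding is_JdLG_projection_def by blast
  then have QP: "Q (P x) = P x"
    using QQ by auto
  have "P (x - P x) = 0"
    by (simp add: linear_diff[OF lin(1)] PP)
  then have "Q (x - P x) = 0"
    using assms unfolding is_JdLG_projection_def by blast
  then show "P x = Q x"
    by (simp add: linear_diff[OF lin(2)] QP)
qed

text \<open>For a JdLG-admissible \<open>\<pi>\<close> the space splits as the direct sum of \<open>E_r \<pi>\<close> and \<open>E_aws \<pi>\<close>,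
  so that this operator exists.\<close>

definition JdLG_projection :: "('s \<Rightarrow> 'e::complex_banach \<Rightarrow> 'e) \<Rightarrow> 'e \<Rightarrow> 'e"
  where "JdLG_projection \<pi> = (THE Q. is_JdLG_projection \<pi> Q)"

section \<open>The Stone--Cech compactification of a discrete semigroup\<close>

text \<open>Ultrafilters are represented by the library type of filters; a set \<open>A\<close> is a member
  of \<open>p\<close> if \<open>\<forall>\<^sub>F s in p. s \<in> A\<close>. With this encoding, \<open>p-lim\<close> of \<open>f\<close> in a space \<open>X\<close> being equal
  to \<open>x\<close> is \<open>limitin X f x p\<close>.\<close>

definition ultrafilters :: "'a filter set"
  where "ultrafilters = {p. p \<noteq> bot \<and>
    (\<forall>A. (\<forall>\<^sub>F s in p. s \<in> A) \<or> (\<forall>\<^sub>F s in p. s \<notin> A))}"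

definition uf_topology :: "'a filter topology"
  where "uf_topology = topology_generated_by
    {{p \<in> ultrafilters. \<forall>\<^sub>F s in p. s \<in> A} | A. True}"

definition uf_mult :: "('a \<Rightarrow> 'a \<Rightarrow> 'a) \<Rightarrow> 'a filter \<Rightarrow> 'a filter \<Rightarrow> 'a filter"
  where "uf_mult f q p = Abs_filter (\<lambda>P. \<forall>\<^sub>F s in q. \<forall>\<^sub>F t in p. P (f s t))"

lemma eventually_uf_mult:
  "(\<forall>\<^sub>F x in uf_mult f q p. P x) \<longleftrightarrow> (\<forall>\<^sub>F s in q. \<forall>\<^sub>F t in p. P (f s t))"
  unfolding uf_mult_def
proof (rule eventually_Abs_filter, rule is_filter.intro)
  fix P Q :: "'a \<Rightarrow> bool"
  assume "\<forall>\<^sub>F s in q. \<forall>\<^sub>F t in p. P (f s t)" "\<forall>\<^sub>F s in q. \<forall>\<^sub>F t in p. Q (f s t)"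
  then show "\<forall>\<^sub>F s in q. \<forall>\<^sub>F t in p. P (f s t) \<and> Q (f s t)"
    by (rule eventually_elim2) (rule eventually_conj)
next
  fix P Q :: "'a \<Rightarrow> bool"
  assume "\<forall>x. P x \<longrightarrow> Q x" "\<forall>\<^sub>F s in q. \<forall>\<^sub>F t in p. P (f s t)"
  then show "\<forall>\<^sub>F s in q. \<forall>\<^sub>F t in p. Q (f s t)"
    by (auto elim!: eventually_mono)
qed auto

lemma uf_mult_mem:
  "(\<forall>\<^sub>F x in uf_mult f q p. x \<in> A) \<longleftrightarrow> (\<forall>\<^sub>F s in q. s \<in> {s. \<forall>\<^sub>F t in p. t \<in> {t. f s t \<in> A}})"
  by (simp add: eventually_uf_mult)

definition K_beta :: "'s::semigroup_mult filter set"
  where "K_beta = smallest_ideal ultrafilters (uf_mult (*))"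

section \<open>Amenability and upper Banach density\<close>

text \<open>A mean is a functional on the bounded functions; its values at unbounded functions are
  irrelevant.\<close>

definition is_mean :: "(('s \<Rightarrow> complex) \<Rightarrow> complex) \<Rightarrow> bool"
  where "is_mean m \<longleftrightarrow>
    (\<forall>f g. bounded (range f) \<and> bounded (range g) \<longrightarrow> m (\<lambda>s. f s + g s) = m f + m g) \<and>
    (\<forall>c f. bounded (range f) \<longrightarrow> m (\<lambda>s. c * f s) = c * m f) \<and>
    (\<forall>f. bounded (range f) \<and> (\<forall>s. f s \<in> \<real>\<^sub>\<ge>\<^sub>0) \<longrightarrow> m f \<in> \<real>\<^sub>\<ge>\<^sub>0) \<and>
    bdd_above {cmod (m f) | f. \<forall>s. cmod (f s) \<le> 1} \<and>
    Sup {cmod (m f) | f. \<forall>s. cmod (f s) \<le> 1} = 1"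

definition left_invariant_mean :: "(('s::semigroup_mult \<Rightarrow> complex) \<Rightarrow> complex) \<Rightarrow> bool"
  where "left_invariant_mean m \<longleftrightarrow>
    is_mean m \<and> (\<forall>s f. bounded (range f) \<longrightarrow> m (\<lambda>t. f (s * t)) = m f)"

definition bi_invariant_mean :: "(('s::semigroup_mult \<Rightarrow> complex) \<Rightarrow> complex) \<Rightarrow> bool"
  where "bi_invariant_mean m \<longleftrightarrow>
    left_invariant_mean m \<and> (\<forall>s f. bounded (range f) \<longrightarrow> m (\<lambda>t. f (t * s)) = m f)"

definition bi_amenable :: "'s::semigroup_mult itself \<Rightarrow> bool"
  where "bi_amenable _ \<longleftrightarrow> (\<exists>m :: ('s \<Rightarrow> complex) \<Rightarrow> complex. bi_invariant_mean m)"

text \<open>Meaningful only for left-amenable semigroups: otherwise the supremum is over the empty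
  set.\<close>

definition upper_density :: "'s::semigroup_mult set \<Rightarrow> real"
  where "upper_density A = Sup {Re (m (indicator A)) | m. left_invariant_mean m}"

definition D_star :: "'s::semigroup_mult filter set"
  where "D_star = {p \<in> ultrafilters. \<forall>A. (\<forall>\<^sub>F s in p. s \<in> A) \<longrightarrow> upper_density A > 0}"

section \<open>Cancellative left reversible semigroups and groups of right quotients\<close>

definition cancellative :: "'s::semigroup_mult itself \<Rightarrow> bool"
  where "cancellative _ \<longleftrightarrow> (\<forall>a b c :: 's. a * b = a * c \<or> b * a = c * a \<longrightarrow> b = c)"

definition left_reversible :: "'s::semigroup_mult itself \<Rightarrow> bool"
  where "left_reversible _ \<longleftrightarrow> (\<forall>r s :: 's. range ((*) r) \<inter> range ((*) s) \<noteq> {})"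

text \<open>Here \<open>\<iota>\<close> is the embedding of the semigroup into the group \<open>'g\<close> with multiplication \<open>gm\<close>,
  identity \<open>ge\<close> and inversion \<open>gi\<close>; \<^locale>\<open>group\<close> is the locale of the theory of groups in Main.\<close>

definition group_of_right_quotients ::
    "('s::semigroup_mult \<Rightarrow> 'g) \<Rightarrow> ('g \<Rightarrow> 'g \<Rightarrow> 'g) \<Rightarrow> 'g \<Rightarrow> ('g \<Rightarrow> 'g) \<Rightarrow> bool"
  where "group_of_right_quotients \<iota> gm ge gi \<longleftrightarrow>
    group gm ge gi \<and> inj \<iota> \<and> (\<forall>s t. \<iota> (s * t) = gm (\<iota> s) (\<iota> t)) \<and>
    (\<forall>g. \<exists>s t. g = gm (\<iota> s) (gi (\<iota> t)))"

text \<open>The assertion \<open>p = q\<inverse>q\<close> for ultrafilters \<open>p, q\<close> on the semigroup, the product being taken in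
  the ultrafilters on the group, into which the ultrafilters on the semigroup embed by
  \<open>filtermap \<iota>\<close>.\<close>

definition is_inverse_product ::
    "('s \<Rightarrow> 'g) \<Rightarrow> ('g \<Rightarrow> 'g \<Rightarrow> 'g) \<Rightarrow> ('g \<Rightarrow> 'g) \<Rightarrow> 's filter \<Rightarrow> 's filter \<Rightarrow> bool"
  where "is_inverse_product \<iota> gm gi p q \<longleftrightarrow>
    filtermap \<iota> p = uf_mult gm (filtermap gi (filtermap \<iota> q)) (filtermap \<iota> q)"

end

theory Submission
  imports Defs
begin

text \<open>Let \<open>Q\<close> be the minimal idempotent of the weak operator closure \<open>\<S>\<close> of \<open>\<pi>(S)\<close>. By the
  Ellis--Numakura lemma \<open>Q\<close> is central in \<open>\<S>\<close>, the smallest ideal \<open>\<K> = {u. u Q = u}\<close> is a compact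
  group with identity \<open>Q\<close>, and \<open>Q\<close> is the JdLG projection. As \<open>p \<mapsto> \<pi>\<^sub>p\<close> is a homomorphism, (i) and
  (ii) follow once \<open>\<pi>\<^sub>p \<in> \<K>\<close>, that is, once \<open>\<pi>\<^sub>p\<close> vanishes on the kernel of \<open>Q\<close>. For \<open>p\<close> in the closure of
  \<open>K(\<beta>S)\<close> this holds because the preimage of \<open>\<K>\<close> is an ideal of \<open>\<beta>S\<close>. For \<open>p \<in> \<D>\<^sup>*(S)\<close> it suffices that
  \<open>{s. \<bar>\<phi>(\<pi>\<^sub>s \<zeta>)\<bar> \<ge> \<epsilon>}\<close> is null for every left-invariant mean whenever \<open>Q \<zeta> = 0\<close>; otherwise, among
  translates of positive measure, one finds two sequences violating the double limit property of \<open>\<S>\<close>.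

  In (iii) and (iv), \<open>\<pi>\<^sub>p\<close> is the limit along \<open>s \<rightarrow> q\<close> of operators \<open>V\<^sub>s\<close> with \<open>\<pi>\<^sub>q = \<pi>\<^sub>s V\<^sub>s\<close>, and
  \<open>Q V\<^sub>s = (Q \<pi>\<^sub>s)\<inverse> \<pi>\<^sub>q\<close> tends to \<open>\<pi>\<^sub>q\<inverse> \<pi>\<^sub>q = Q\<close>, because inversion on the compact semitopological group
  \<open>\<K>\<close> is continuous (Ellis), which again is derived from the double limit property.\<close>

section \<open>Ultrafilters\<close>

lemma ultrafilters_not_bot: "p \<in> ultrafilters \<Longrightarrow> p \<noteq> bot"
  by (simp add: ultrafilters_def)

lemma not_eventually_ultrafilter:
  assumes "p \<in> ultrafilters"
  shows "\<not> (\<forall>\<^sub>F s in p. P s) \<longleftrightarrow> (\<forall>\<^sub>F s in p. \<not> P s)"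
proof
  have "(\<forall>\<^sub>F s in p. s \<in> Collect P) \<or> (\<forall>\<^sub>F s in p. s \<notin> Collect P)"
    using assms unfolding ultrafilters_def by blast
  then show "\<forall>\<^sub>F s in p. \<not> P s" if "\<not> (\<forall>\<^sub>F s in p. P s)"
    using that by simp
  show "\<not> (\<forall>\<^sub>F s in p. P s)" if "\<forall>\<^sub>F s in p. \<not> P s"
    using eventually_conj[OF that, of P] ultrafilters_not_bot[OF assms]
    by (auto simp: trivial_limit_def)
qed

lemma eventually_disj_ultrafilter:
  assumes "p \<in> ultrafilters"
  shows "(\<forall>\<^sub>F s in p. P s \<or> Q s) \<longleftrightarrow> (\<forall>\<^sub>F s in p. P s) \<or> (\<forall>\<^sub>F s in p. Q s)"
proof -
  have "(\<forall>\<^sub>F s in p. P s \<or> Q s) \<longleftrightarrow> \<not> (\<forall>\<^sub>F s in p. \<not> P s \<and> \<not> Q s)"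
    by (simp add: not_eventually_ultrafilter[OF assms])
  then show ?thesis
    by (simp add: eventually_conj_iff not_eventually_ultrafilter[OF assms, symmetric])
qed

lemma eventually_bex_ultrafilter:
  assumes "p \<in> ultrafilters" and "finite I"
  shows "(\<forall>\<^sub>F s in p. \<exists>i\<in>I. P i s) \<longleftrightarrow> (\<exists>i\<in>I. \<forall>\<^sub>F s in p. P i s)"
  using assms(2)
proof induction
  case empty
  then show ?case
    using ultrafilters_not_bot[OF assms(1)] by (simp add: trivial_limit_def)
next
  case (insert i I)
  then show ?case
    by (simp add: eventually_disj_ultrafilter[OF assms(1)])
qed

text \<open>Zorn's lemma yields a minimal proper filter below \<open>F\<close>. It is an
  ultrafilter, because intersecting it with the principal filter of a set either gives
  \<open>bot\<close> or changes nothing.\<close>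

lemma ex_ultrafilter_le:
  fixes F :: "'a filter"
  assumes "F \<noteq> bot"
  shows "\<exists>p\<in>ultrafilters. p \<le> F"
proof -
  define A where "A = {G. G \<noteq> bot \<and> G \<le> F}"
  define R where "R = (\<lambda>G H :: 'a filter. H \<le> G)"
  have "\<exists>m\<in>A. \<forall>a\<in>A. R m a \<longrightarrow> a = m"
  proof (rule predicate_Zorn)
    show "partial_order_on A (relation_of R A)"
      by (auto simp: partial_order_on_def preorder_on_def refl_on_def trans_def antisym_def
          relation_of_def R_def)
  next
    fix C assume "C \<in> Chains (relation_of R A)"
    then have CA: "C \<subseteq> A" and ch: "\<And>G H. G \<in> C \<Longrightarrow> H \<in> C \<Longrightarrow> G \<le> H \<or> H \<le> G"
      by (auto simp: Chains_def relation_of_def R_def)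
    show "\<exists>u\<in>A. \<forall>a\<in>C. R a u"
    proof (cases "C = {}")
      case True
      with assms show ?thesis by (auto simp: A_def)
    next
      case False
      \<comment> \<open>A chain is directed, so whatever holds eventually in the infimum holds
        eventually in a single member; hence the infimum stays proper.\<close>
      have "eventually P (Inf C) \<longleftrightarrow> (\<exists>G\<in>C. eventually P G)" for P
      proof (rule eventually_Inf_base[OF False])
        fix G H assume GH: "G \<in> C" "H \<in> C"
        from ch[OF this] show "\<exists>x\<in>C. x \<le> inf G H"
          using GH by (elim disjE) (auto intro: bexI[of _ G] bexI[of _ H])
      qed
      then have "Inf C \<noteq> bot"
        using CA by (auto simp: A_def trivial_limit_def)
      moreover have "Inf C \<le> F"
        using False CA by (auto simp: A_def intro: Inf_lower2)
      ultimately show ?thesis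
        unfolding A_def R_def by (blast intro: Inf_lower)
    qed
  qed
  then obtain m where mA: "m \<in> A" and mR: "\<And>a. a \<in> A \<Longrightarrow> a \<le> m \<Longrightarrow> a = m"
    unfolding R_def by blast
  then have m: "m \<noteq> bot" "m \<le> F" and
    min: "\<And>a. a \<noteq> bot \<Longrightarrow> a \<le> m \<Longrightarrow> a = m"
    unfolding A_def by (auto intro: order_trans)
  have "(\<forall>\<^sub>F s in m. s \<in> B) \<or> (\<forall>\<^sub>F s in m. s \<notin> B)" for B
  proof (cases "inf m (principal B) = bot")
    case True
    then show ?thesis by (simp add: trivial_limit_def eventually_inf_principal)
  next
    case False
    then have "inf m (principal B) = m" by (intro min) auto
    then have "m \<le> principal B" by (simp add: inf.absorb_iff1)
    then show ?thesis by (simp add: le_principal)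
  qed
  with m show ?thesis by (auto simp: ultrafilters_def)
qed

lemma ex_ultrafilter_fip:
  assumes "\<And>\<F>. finite \<F> \<Longrightarrow> \<F> \<subseteq> \<A> \<Longrightarrow> \<Inter>\<F> \<noteq> {}"
  shows "\<exists>p\<in>ultrafilters. \<forall>A\<in>\<A>. \<forall>\<^sub>F s in p. s \<in> A"
proof -
  have "(INF A\<in>\<A>. principal A) \<noteq> bot"
    unfolding trivial_limit_def
  proof
    assume "\<forall>\<^sub>F x in INF A\<in>\<A>. principal A. False"
    then obtain X where X: "finite X" "X \<subseteq> \<A>" "(INF A\<in>X. principal A) = bot"
      by (auto simp: eventually_INF[of _ _ \<A>] trivial_limit_def)
    have "(INF A\<in>X. principal A) = principal (\<Inter>X)"
      using X(1) by (simp add: INF_principal_finite)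
    with X assms[of X] show False
      by (simp add: principal_eq_bot_iff)
  qed
  then obtain p where p: "p \<in> ultrafilters" "p \<le> (INF A\<in>\<A>. principal A)"
    using ex_ultrafilter_le by blast
  then have "p \<le> principal A" if "A \<in> \<A>" for A
    using that by (simp add: le_INF_iff)
  with p(1) show ?thesis
    by (auto simp: le_principal)
qed

lemma uf_mult_ultrafilters:
  assumes "p \<in> ultrafilters" and "q \<in> ultrafilters"
  shows "uf_mult f q p \<in> ultrafilters"
proof -
  have "uf_mult f q p \<noteq> bot"
    using ultrafilters_not_bot[OF assms(1)] ultrafilters_not_bot[OF assms(2)]
    by (simp add: trivial_limit_def eventually_uf_mult)
  moreover have "(\<forall>\<^sub>F s in uf_mult f q p. s \<in> A) \<or> (\<forall>\<^sub>F s in uf_mult f q p. s \<notin> A)" for A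
    by (simp add: eventually_uf_mult not_eventually_ultrafilter[OF assms(2), symmetric]
        not_eventually_ultrafilter[OF assms(1), symmetric])
  ultimately show ?thesis by (simp add: ultrafilters_def)
qed

text \<open>For \<open>f\<close> the left translation by \<open>s\<close> this is the ultrafilter
  s^{-1} q: it exists as soon as s S belongs to \<open>q\<close>, and translating it back by
  \<open>s\<close> returns \<open>q\<close>.\<close>

lemma filtercomap_inj_ultrafilter:
  assumes q: "q \<in> ultrafilters" and inj: "inj f" and ran: "\<forall>\<^sub>F t in q. t \<in> range f"
  shows "filtercomap f q \<in> ultrafilters" and "filtermap f (filtercomap f q) = q"
proof -
  have ev: "(\<forall>\<^sub>F r in filtercomap f q. P r) \<longleftrightarrow> (\<forall>\<^sub>F t in q. t \<in> f ` Collect P)" for P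
  proof
    assume "\<forall>\<^sub>F r in filtercomap f q. P r"
    then obtain R where R: "eventually R q" "\<And>x. R (f x) \<Longrightarrow> P x"
      unfolding eventually_filtercomap by blast
    show "\<forall>\<^sub>F t in q. t \<in> f ` Collect P"
      using R(1) ran by eventually_elim (use R(2) in auto)
  next
    assume "\<forall>\<^sub>F t in q. t \<in> f ` Collect P"
    then show "\<forall>\<^sub>F r in filtercomap f q. P r"
      unfolding eventually_filtercomap
      by (intro exI[of _ "\<lambda>t. t \<in> f ` Collect P"]) (auto simp: inj_image_mem_iff[OF inj])
  qed
  have "filtercomap f q \<noteq> bot"
    using ultrafilters_not_bot[OF q] by (simp add: trivial_limit_def ev)
  moreover have "(\<forall>\<^sub>F s in filtercomap f q. s \<in> A) \<or> (\<forall>\<^sub>F s in filtercomap f q. s \<notin> A)" for A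
    unfolding ev eventually_disj_ultrafilter[OF q, symmetric]
    using ran by eventually_elim auto
  ultimately show "filtercomap f q \<in> ultrafilters" by (simp add: ultrafilters_def)
  show "filtermap f (filtercomap f q) = q"
    unfolding filter_eq_iff eventually_filtermap ev
  proof (intro allI iffI)
    fix P assume "\<forall>\<^sub>F t in q. t \<in> f ` {x. P (f x)}"
    then show "eventually P q" by eventually_elim auto
  next
    fix P assume "eventually P q"
    then show "\<forall>\<^sub>F t in q. t \<in> f ` {x. P (f x)}" using ran by eventually_elim auto
  qed
qed

lemma in_uf_closure_ofD:
  assumes "p \<in> uf_topology closure_of \<A>" and "\<forall>\<^sub>F s in p. P s"
  shows "\<exists>k\<in>\<A>. \<forall>\<^sub>F s in k. P s"
proof -
  have "p \<in> topspace uf_topology"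
    using assms(1) by (simp add: in_closure_of)
  then have "p \<in> ultrafilters"
    unfolding uf_topology_def topology_generated_by_topspace by auto
  moreover have "openin uf_topology {p \<in> ultrafilters. \<forall>\<^sub>F s in p. s \<in> Collect P}"
    unfolding uf_topology_def by (rule topology_generated_by_Basis) blast
  moreover have "p \<in> {p \<in> ultrafilters. \<forall>\<^sub>F s in p. s \<in> Collect P}"
    using \<open>p \<in> ultrafilters\<close> assms(2) by simp
  moreover have "\<forall>T. p \<in> T \<and> openin uf_topology T \<longrightarrow> (\<exists>y. y \<in> \<A> \<and> y \<in> T)"
    using assms(1) by (simp add: in_closure_of)
  ultimately obtain k where "k \<in> \<A>" "k \<in> {p \<in> ultrafilters. \<forall>\<^sub>F s in p. s \<in> Collect P}"
    by meson
  then show ?thesis by (intro bexI[of _ k]) simp_all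
qed

lemma uf_closure_of_subset_ultrafilters: "uf_topology closure_of \<A> \<subseteq> ultrafilters"
  using closure_of_subset_topspace[of uf_topology \<A>]
  unfolding uf_topology_def topology_generated_by_topspace by auto

text \<open>If no point of \<open>C\<close> were a limit, each would have an open neighbourhood not
  caught by \<open>p\<close>; finitely many of these cover \<open>C\<close>, and an ultrafilter must
  catch one of them.\<close>

lemma compactin_ultrafilter_limit:
  assumes C: "compactin X C" and p: "p \<in> ultrafilters" and f: "\<forall>\<^sub>F i in p. f i \<in> C"
  shows "\<exists>x\<in>C. limitin X f x p"
proof (rule ccontr)
  assume "\<not> ?thesis"
  moreover have sub: "C \<subseteq> topspace X"
    using C by (simp add: compactin_subset_topspace)
  ultimately have "\<forall>x\<in>C. \<exists>U. openin X U \<and> x \<in> U \<and> \<not> (\<forall>\<^sub>F i in p. f i \<in> U)"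
    unfolding limitin_def by blast
  then obtain U where U: "\<And>x. x \<in> C \<Longrightarrow> openin X (U x) \<and> x \<in> U x \<and> \<not> (\<forall>\<^sub>F i in p. f i \<in> U x)"
    by metis
  have "\<exists>\<F>. finite \<F> \<and> \<F> \<subseteq> U ` C \<and> C \<subseteq> \<Union>\<F>"
    using C U by (intro compactinD) auto
  then obtain \<F> where F: "finite \<F>" "\<F> \<subseteq> U ` C" "C \<subseteq> \<Union>\<F>" by blast
  have "\<forall>\<^sub>F i in p. \<exists>V\<in>\<F>. f i \<in> V"
    using f by eventually_elim (use F in auto)
  then obtain V where "V \<in> \<F>" "\<forall>\<^sub>F i in p. f i \<in> V"
    by (auto simp: eventually_bex_ultrafilter[OF p F(1)])
  moreover obtain x where "x \<in> C" "V = U x"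
    using F(2) \<open>V \<in> \<F>\<close> by blast
  ultimately show False using U[of x] by blast
qed

section \<open>The dual of a complex Banach space separates points\<close>

text \<open>The functionals among which Zorn's lemma finds a minimal one, as in the Hahn-Banach
  theorem. Domination by the norm keeps pointwise infima of chains finite and makes the resulting
  linear functional bounded.\<close>

definition dominated_sublinear :: "('e::real_normed_vector \<Rightarrow> real) \<Rightarrow> bool"
  where "dominated_sublinear p \<longleftrightarrow>
    (\<forall>x y. p (x + y) \<le> p x + p y) \<and> (\<forall>c>0. \<forall>x. p (c *\<^sub>R x) \<le> c * p x) \<and> (\<forall>x. p x \<le> norm x)"

lemma dominated_sublinear_norm: "dominated_sublinear norm"
  by (simp add: dominated_sublinear_def norm_triangle_ineq)

context
  fixes p :: "'e::real_normed_vector \<Rightarrow> real"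
  assumes p: "dominated_sublinear p"
begin

lemma sublinear_add: "p (x + y) \<le> p x + p y"
  and sublinear_le_norm: "p x \<le> norm x"
  using p by (auto simp: dominated_sublinear_def)

lemma sublinear_scaleR:
  assumes "c > 0"
  shows "p (c *\<^sub>R x) = c * p x"
proof (rule antisym)
  show "p (c *\<^sub>R x) \<le> c * p x"
    using p assms by (auto simp: dominated_sublinear_def)
  have "p (inverse c *\<^sub>R (c *\<^sub>R x)) \<le> inverse c * p (c *\<^sub>R x)"
    using p assms unfolding dominated_sublinear_def by (metis positive_imp_inverse_positive)
  then show "c * p x \<le> p (c *\<^sub>R x)"
    using assms by (simp add: field_simps)
qed

lemma sublinear_0: "p 0 = 0"
  using sublinear_le_norm[of 0] sublinear_add[of 0 0] by simp

lemma sublinear_minus: "- p (- x) \<le> p x"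
  using sublinear_add[of x "- x"] sublinear_0 by simp

text \<open>Pushing \<open>p\<close> down along the ray through \<open>y\<close>; a minimal \<open>p\<close> is not changed by this, hence odd.\<close>

lemma sublinear_decrease:
  "\<exists>q. dominated_sublinear q \<and> q \<le> p \<and> q (- y) \<le> - p y"
proof -
  define g where "g = (\<lambda>x t. p (x + t *\<^sub>R y) - t * p y)"
  define q where "q = (\<lambda>x. INF t\<in>{0..}. g x t)"
  have low: "- p (- x) \<le> g x t" if "t \<ge> 0" for x t
  proof -
    have "t * p y = p (t *\<^sub>R y)"
      using that sublinear_scaleR[of t y] sublinear_0 by (cases "t = 0") auto
    also have "\<dots> \<le> p (x + t *\<^sub>R y) + p (- x)"
      using sublinear_add[of "x + t *\<^sub>R y" "- x"] by simp
    finally show ?thesis by (simp add: g_def)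
  qed
  then have bdd: "bdd_below (g x ` {0..})" for x
    by (intro bdd_belowI[of _ "- p (- x)"]) auto
  have q_le: "q x \<le> g x t" if "t \<ge> 0" for x t
    unfolding q_def using bdd that by (intro cINF_lower) auto
  have q_ge: "c \<le> q x" if "\<And>t. t \<ge> 0 \<Longrightarrow> c \<le> g x t" for x c
    unfolding q_def using that by (intro cINF_greatest) auto
  have le: "q \<le> p"
    using q_le[of 0] by (auto simp: le_fun_def g_def)
  have "q (x + z) \<le> q x + q z" for x z
  proof -
    have 1: "q (x + z) \<le> g x s + g z t" if "s \<ge> 0" "t \<ge> 0" for s t
    proof -
      have "g (x + z) (s + t) \<le> g x s + g z t"
        using sublinear_add[of "x + s *\<^sub>R y" "z + t *\<^sub>R y"]
        by (simp add: g_def algebra_simps)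
      then show ?thesis
        using q_le[of "s + t" "x + z"] that by simp
    qed
    have "q (x + z) - g x s \<le> q z" if "s \<ge> 0" for s
      using 1[OF that] by (intro q_ge) (simp add: algebra_simps)
    then have "q (x + z) - q z \<le> q x"
      by (intro q_ge) (simp add: algebra_simps)
    then show ?thesis by simp
  qed
  moreover have "q (c *\<^sub>R x) \<le> c * q x" if c: "c > 0" for c x
  proof -
    have "q (c *\<^sub>R x) / c \<le> q x"
    proof (rule q_ge)
      fix t :: real assume "t \<ge> 0"
      then have "q (c *\<^sub>R x) \<le> g (c *\<^sub>R x) (c * t)"
        using c by (intro q_le) simp
      also have "\<dots> = c * g x t"
        using sublinear_scaleR[OF c, of "x + t *\<^sub>R y"] by (simp add: g_def algebra_simps)
      finally show "q (c *\<^sub>R x) / c \<le> g x t"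
        using c by (simp add: field_simps)
    qed
    then show ?thesis
      using c by (simp add: field_simps)
  qed
  moreover have "q x \<le> norm x" for x
    using le sublinear_le_norm[of x] by (meson le_funD order_trans)
  ultimately have "dominated_sublinear q"
    by (simp add: dominated_sublinear_def)
  moreover have "q (- y) \<le> - p y"
    using q_le[of 1 "- y"] sublinear_0 by (simp add: g_def)
  ultimately show ?thesis using le by blast
qed

end

lemma ex_minimal_dominated_sublinear:
  fixes p :: "'e::real_normed_vector \<Rightarrow> real"
  assumes p: "dominated_sublinear p"
  shows "\<exists>m\<le>p. dominated_sublinear m \<and> (\<forall>q\<le>m. dominated_sublinear q \<longrightarrow> q = m)"
proof -
  define A where "A = {q. dominated_sublinear q \<and> q \<le> p}"
  define R where "R = (\<lambda>q r :: 'e \<Rightarrow> real. r \<le> q)"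
  have "\<exists>m\<in>A. \<forall>a\<in>A. R m a \<longrightarrow> a = m"
  proof (rule predicate_Zorn)
    show "partial_order_on A (relation_of R A)"
      by (auto simp: partial_order_on_def preorder_on_def refl_on_def trans_def antisym_def
          relation_of_def R_def)
  next
    fix C assume "C \<in> Chains (relation_of R A)"
    then have CA: "C \<subseteq> A" and ch: "\<And>q r. q \<in> C \<Longrightarrow> r \<in> C \<Longrightarrow> q \<le> r \<or> r \<le> q"
      by (auto simp: Chains_def relation_of_def R_def)
    then have sub: "dominated_sublinear q" if "q \<in> C" for q
      using that by (auto simp: A_def)
    show "\<exists>u\<in>A. \<forall>a\<in>C. R a u"
    proof (cases "C = {}")
      case True
      with p show ?thesis by (auto simp: A_def)
    next
      case False
      define u where "u = (\<lambda>x. INF q\<in>C. q x)"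
      have "- norm x \<le> q x" if "q \<in> C" for q x
        using sublinear_minus[OF sub[OF that], of x] sublinear_le_norm[OF sub[OF that], of "- x"]
        by simp
      then have "bdd_below ((\<lambda>q. q x) ` C)" for x
        by (intro bdd_belowI[of _ "- norm x"]) auto
      then have u_le: "u x \<le> q x" if "q \<in> C" for q x
        unfolding u_def using that by (intro cINF_lower) auto
      have u_ge: "c \<le> u x" if "\<And>q. q \<in> C \<Longrightarrow> c \<le> q x" for c x
        unfolding u_def using that False by (intro cINF_greatest) auto
      have "u (x + y) \<le> u x + u y" for x y
      proof -
        \<comment> \<open>Of two comparable members the smaller one serves at both points; this is
          how the infimum of a chain stays subadditive.\<close>
        have 1: "u (x + y) \<le> q x + r y" if qr: "q \<in> C" "r \<in> C" for q r
          using ch[OF qr]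
        proof
          assume "q \<le> r"
          then have "q y \<le> r y" by (simp add: le_fun_def)
          then show ?thesis
            using u_le[OF qr(1), of "x + y"] sublinear_add[OF sub[OF qr(1)], of x y] by linarith
        next
          assume "r \<le> q"
          then have "r x \<le> q x" by (simp add: le_fun_def)
          then show ?thesis
            using u_le[OF qr(2), of "x + y"] sublinear_add[OF sub[OF qr(2)], of x y] by linarith
        qed
        have "u (x + y) - q x \<le> u y" if "q \<in> C" for q
          using 1[OF that] by (intro u_ge) (simp add: algebra_simps)
        then have "u (x + y) - u y \<le> u x"
          by (intro u_ge) (simp add: algebra_simps)
        then show ?thesis by simp
      qed
      moreover have "u (c *\<^sub>R x) \<le> c * u x" if c: "c > 0" for c x
      proof -
        have "u (c *\<^sub>R x) / c \<le> u x"
          using u_le[of _ "c *\<^sub>R x"] sublinear_scaleR[OF sub c] c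
          by (intro u_ge) (simp add: field_simps)
        then show ?thesis
          using c by (simp add: field_simps)
      qed
      moreover obtain q where "q \<in> C" using False by blast
      then have "u x \<le> norm x" for x
        using u_le[of q x] sublinear_le_norm[OF sub, of q x] by simp
      ultimately have "dominated_sublinear u"
        by (simp add: dominated_sublinear_def)
      moreover have "u \<le> p"
        using u_le \<open>q \<in> C\<close> CA unfolding A_def le_fun_def by (blast intro: order_trans)
      ultimately show ?thesis
        using u_le by (intro bexI[of _ u]) (auto simp: A_def R_def le_fun_def)
    qed
  qed
  then obtain m where "m \<in> A" and mR: "\<And>a. a \<in> A \<Longrightarrow> a \<le> m \<Longrightarrow> a = m"
    unfolding R_def by blast
  then show ?thesis
    unfolding A_def by (intro exI[of _ m]) (auto intro: order_trans)
qed

text \<open>The norm is pushed down until its value at \<open>- x\<close> is at most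
  \<open>- norm x\<close>, and then to a minimal functional. Minimality makes it odd, an odd
  sublinear functional is linear, and oddness turns the bound at \<open>- x\<close> into the one at
  \<open>x\<close>.\<close>

lemma ex_norming_functional:
  fixes x :: "'e::real_normed_vector"
  shows "\<exists>g::'e \<Rightarrow> real. bounded_linear g \<and> g x \<ge> norm x \<and> (\<forall>y. \<bar>g y\<bar> \<le> norm y)"
proof -
  obtain p where p: "dominated_sublinear p" "p (- x) \<le> - norm x"
    using sublinear_decrease[OF dominated_sublinear_norm] by blast
  obtain m where m: "m \<le> p" "dominated_sublinear m"
    and min: "\<And>q. q \<le> m \<Longrightarrow> dominated_sublinear q \<Longrightarrow> q = m"
    using ex_minimal_dominated_sublinear[OF p(1)] by blast
  have "m (- y) \<le> - m y" for y
    using sublinear_decrease[OF m(2), of y] min by blast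
  then have odd: "m (- y) = - m y" for y
    using sublinear_minus[OF m(2), of y] by (smt (verit))
  have add: "m (y + z) = m y + m z" for y z
    using sublinear_add[OF m(2), of y z] sublinear_add[OF m(2), of "- y" "- z"]
      odd[of y] odd[of z] odd[of "y + z"] by simp
  have scale: "m (c *\<^sub>R y) = c * m y" for c y
  proof (cases c "0::real" rule: linorder_cases)
    case less
    then have "m ((- c) *\<^sub>R y) = (- c) * m y"
      by (intro sublinear_scaleR[OF m(2)]) simp
    then show ?thesis using odd[of "c *\<^sub>R y"] by simp
  qed (auto simp: sublinear_0[OF m(2)] sublinear_scaleR[OF m(2)])
  have bound: "\<bar>m y\<bar> \<le> norm y" for y
    using sublinear_le_norm[OF m(2), of y] sublinear_le_norm[OF m(2), of "- y"] odd[of y] by simp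
  have "bounded_linear m"
    by (rule bounded_linear_intro[of _ 1]) (use add scale bound in auto)
  moreover have "m x \<ge> norm x"
    using odd[of x] m(1) p(2) by (smt (verit) le_funD)
  ultimately show ?thesis using bound by blast
qed

lemma bounded_linear_scaleC: "bounded_linear (\<lambda>x::'e::complex_banach. c *\<^sub>C x)"
proof (rule bounded_linear_intro[of _ "cmod c"])
  fix r and x :: 'e
  show "c *\<^sub>C r *\<^sub>R x = r *\<^sub>R c *\<^sub>C x"
    by (simp add: scaleC_of_real[symmetric] scaleC_scaleC mult.commute)
qed (auto simp: scaleC_add_right norm_scaleC)

lemma ex_bounded_clinear_functional:
  fixes x :: "'e::complex_banach"
  assumes "x \<noteq> 0"
  shows "\<exists>\<phi> :: 'e \<Rightarrow> complex. bounded_clinear \<phi> \<and> \<phi> x \<noteq> 0"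
proof -
  obtain g :: "'e \<Rightarrow> real" where g: "bounded_linear g" "g x \<ge> norm x"
    using ex_norming_functional by blast
  interpret g: bounded_linear g by (rule g)
  \<comment> \<open>The usual complexification, the only complex linear functional with real part
    \<open>g\<close>.\<close>
  define \<phi> where "\<phi> y = Complex (g y) (- g (\<i> *\<^sub>C y))" for y
  have \<phi>_eq: "\<phi> = (\<lambda>y. complex_of_real (g y) - \<i> * complex_of_real (g (\<i> *\<^sub>C y)))"
    by (auto simp: \<phi>_def complex_eq_iff)
  have "bounded_linear \<phi>"
    unfolding \<phi>_eq
    by (intro bounded_linear_sub bounded_linear_const_mult
        bounded_linear_compose[OF bounded_linear_of_real] g(1)
        bounded_linear_compose[OF g(1) bounded_linear_scaleC])
  moreover have "\<phi> (c *\<^sub>C y) = c *\<^sub>C \<phi> y" for c y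
  proof -
    have dec: "c *\<^sub>C z = Re c *\<^sub>R z + Im c *\<^sub>R \<i> *\<^sub>C z" for z :: 'e
      by (simp add: scaleC_of_real[symmetric] scaleC_scaleC scaleC_add_left[symmetric])
        (metis complex_eq mult.commute)
    have "\<i> *\<^sub>C \<i> *\<^sub>C y = - y"
      using scaleC_of_real[of "- 1" y] by (simp add: scaleC_scaleC)
    then show ?thesis
      by (simp add: \<phi>_def scaleC_complex_def complex_eq_iff dec g.add g.diff g.scaleR g.neg
          bounded_linear.linear[OF bounded_linear_scaleC] linear_add linear_scale algebra_simps)
  qed
  moreover have "\<phi> x \<noteq> 0"
    using assms g(2) by (auto simp: \<phi>_def complex_eq_iff)
  ultimately show ?thesis
    unfolding bounded_clinear_def by blast
qed

section \<open>Limits along ultrafilters\<close>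

text \<open>The sets of indices in \<open>A\<close> that \<open>g\<close> maps into a given
  neighbourhood of \<open>z\<close> have the finite intersection property; any ultrafilter
  containing them all works.\<close>

lemma closure_of_ultrafilter_limit:
  assumes "z \<in> X closure_of (g ` A)"
  shows "\<exists>p\<in>ultrafilters. (\<forall>\<^sub>F s in p. s \<in> A) \<and> limitin X g z p"
proof -
  define \<A> where "\<A> = (\<lambda>U. {s\<in>A. g s \<in> U}) ` {U. openin X U \<and> z \<in> U}"
  have z: "z \<in> topspace X" and ex: "\<And>U. openin X U \<Longrightarrow> z \<in> U \<Longrightarrow> \<exists>s\<in>A. g s \<in> U"
    using assms by (auto simp: in_closure_of)
  have "\<exists>p\<in>ultrafilters. \<forall>B\<in>\<A>. \<forall>\<^sub>F s in p. s \<in> B"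
  proof (rule ex_ultrafilter_fip)
    fix \<F> assume "finite \<F>" "\<F> \<subseteq> \<A>"
    then obtain \<U> where U: "finite \<U>" "\<U> \<subseteq> {U. openin X U \<and> z \<in> U}"
      "\<F> = (\<lambda>U. {s\<in>A. g s \<in> U}) ` \<U>"
      unfolding \<A>_def by (meson finite_subset_image)
    have "openin X (\<Inter>(insert (topspace X) \<U>))"
      by (rule openin_Inter) (use U in auto)
    moreover have "z \<in> \<Inter>(insert (topspace X) \<U>)"
      using U z by auto
    ultimately obtain s where "s \<in> A" "g s \<in> \<Inter>(insert (topspace X) \<U>)"
      using ex by blast
    then have "s \<in> \<Inter>\<F>"
      unfolding U(3) by auto
    then show "\<Inter>\<F> \<noteq> {}" by blast
  qed
  then obtain p where p: "p \<in> ultrafilters" "\<And>B. B \<in> \<A> \<Longrightarrow> \<forall>\<^sub>F s in p. s \<in> B"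
    by blast
  have ev: "\<forall>\<^sub>F s in p. s \<in> A \<and> g s \<in> U" if "openin X U" "z \<in> U" for U
    using p(2)[of "{s\<in>A. g s \<in> U}"] that by (auto simp: \<A>_def)
  have "\<forall>\<^sub>F s in p. s \<in> A"
    using ev[OF openin_topspace z] by eventually_elim auto
  moreover have "limitin X g z p"
    unfolding limitin_def
  proof (intro conjI allI impI)
    fix U assume "openin X U \<and> z \<in> U"
    then have "\<forall>\<^sub>F s in p. s \<in> A \<and> g s \<in> U" using ev by blast
    then show "\<forall>\<^sub>F s in p. g s \<in> U" by eventually_elim auto
  qed (rule z)
  ultimately show ?thesis using p(1) by blast
qed

lemma limitin_imp_closure_of:
  assumes "limitin X g z F" and "F \<noteq> bot" and "\<forall>\<^sub>F s in F. g s \<in> A"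
  shows "z \<in> X closure_of A"
  unfolding in_closure_of
proof (intro conjI allI impI)
  show "z \<in> topspace X"
    using assms(1) by (rule limitin_topspace)
  fix T assume "z \<in> T \<and> openin X T"
  then have "\<forall>\<^sub>F s in F. g s \<in> T"
    using assms(1) by (auto simp: limitin_def)
  then have "\<exists>s. g s \<in> A \<and> g s \<in> T"
    using assms(2,3) eventually_happens' eventually_conj by blast
  then show "\<exists>y. y \<in> A \<and> y \<in> T" by blast
qed

lemma continuous_map_limitin_tendsto:
  assumes "continuous_map X euclidean f" and "limitin X g l F"
  shows "((\<lambda>i. f (g i)) \<longlongrightarrow> f l) F"
  using continuous_map_limit[OF assms] by (simp add: o_def)

section \<open>Semitopological semigroups\<close>

text \<open>Compactness is left to subsets, as the space of all bounded operators is in general not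
  compact. Points are separated by complex functions because the double limit argument evaluates
  such functions.\<close>

locale semitopological_semigroup =
  fixes X :: "'a topology" and mult :: "'a \<Rightarrow> 'a \<Rightarrow> 'a"  (infixl \<open>\<cdot>\<close> 70)
  assumes mult_closed: "x \<in> topspace X \<Longrightarrow> y \<in> topspace X \<Longrightarrow> x \<cdot> y \<in> topspace X"
    and mult_assoc: "x \<cdot> y \<cdot> z = x \<cdot> (y \<cdot> z)"
    and continuous_mult_left: "x \<in> topspace X \<Longrightarrow> continuous_map X X (\<lambda>y. x \<cdot> y)"
    and continuous_mult_right: "y \<in> topspace X \<Longrightarrow> continuous_map X X (\<lambda>x. x \<cdot> y)"
    and functionally_Hausdorff: "x \<in> topspace X \<Longrightarrow> y \<in> topspace X \<Longrightarrow> x \<noteq> y \<Longrightarrow>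
      \<exists>f :: 'a \<Rightarrow> complex. continuous_map X euclidean f \<and> f x \<noteq> f y"
begin

lemma Hausdorff: "Hausdorff_space X"
  unfolding Hausdorff_space_def
proof (intro allI impI)
  fix x y assume xy: "x \<in> topspace X \<and> y \<in> topspace X \<and> x \<noteq> y"
  then obtain f :: "'a \<Rightarrow> complex" where f: "continuous_map X euclidean f" "f x \<noteq> f y"
    using functionally_Hausdorff by blast
  obtain U V where UV: "open U" "open V" "f x \<in> U" "f y \<in> V" "U \<inter> V = {}"
    using hausdorff[OF f(2)] by blast
  show "\<exists>U V. openin X U \<and> openin X V \<and> x \<in> U \<and> y \<in> V \<and> disjnt U V"
    by (rule exI[of _ "{z \<in> topspace X. f z \<in> U}"], rule exI[of _ "{z \<in> topspace X. f z \<in> V}"])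
      (use xy UV openin_continuous_map_preimage[OF f(1)] in \<open>auto simp: disjnt_def\<close>)
qed

lemma compactin_mult_right:
  "compactin X C \<Longrightarrow> y \<in> topspace X \<Longrightarrow> compactin X ((\<lambda>x. x \<cdot> y) ` C)"
  by (rule image_compactin[OF _ continuous_mult_right])

text \<open>Ellis-Numakura: for \<open>e\<close> in a minimal compact subsemigroup \<open>D\<close>,
  both D e and the set of \<open>x\<close> in \<open>D\<close> with \<open>x \<cdot> e = e\<close>
  are compact subsemigroups, hence equal to \<open>D\<close>, so that \<open>e\<close> is
  idempotent.\<close>

lemma compact_subsemigroup_has_idempotent:
  assumes C: "compactin X C" "C \<noteq> {}" "\<And>x y. x \<in> C \<Longrightarrow> y \<in> C \<Longrightarrow> x \<cdot> y \<in> C"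
  shows "\<exists>e\<in>C. e \<cdot> e = e"
proof -
  define A where "A = {D. D \<noteq> {} \<and> D \<subseteq> C \<and> compactin X D \<and> (\<forall>x\<in>D. \<forall>y\<in>D. x \<cdot> y \<in> D)}"
  define R where "R = (\<lambda>D E :: 'a set. E \<subseteq> D)"
  have "\<exists>m\<in>A. \<forall>a\<in>A. R m a \<longrightarrow> a = m"
  proof (rule predicate_Zorn)
    show "partial_order_on A (relation_of R A)"
      by (auto simp: partial_order_on_def preorder_on_def refl_on_def trans_def antisym_def
          relation_of_def R_def)
  next
    fix \<C> assume "\<C> \<in> Chains (relation_of R A)"
    then have CA: "\<C> \<subseteq> A" and ch: "\<And>D E. D \<in> \<C> \<Longrightarrow> E \<in> \<C> \<Longrightarrow> D \<subseteq> E \<or> E \<subseteq> D"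
      by (auto simp: Chains_def relation_of_def R_def)
    show "\<exists>u\<in>A. \<forall>a\<in>\<C>. R a u"
    proof (cases "\<C> = {}")
      case True
      with C show ?thesis by (auto simp: A_def)
    next
      case False
      have cl: "closedin X D" if "D \<in> \<C>" for D
        using that CA compactin_imp_closedin[OF Hausdorff] by (auto simp: A_def)
      have "C \<inter> \<Inter>\<F> \<noteq> {}" if F: "finite \<F>" "\<F> \<subseteq> \<C>" for \<F>
      proof (cases "\<F> = {}")
        case False
        have "subset.chain \<C> \<F>"
          using F(2) ch by (auto simp: subset_chain_def)
        then have "\<Inter>\<F> \<in> A"
          using Inter_in_chain[OF F(1) False] F(2) CA by blast
        then show ?thesis by (auto simp: A_def)
      qed (use C in auto)
      then have ne: "C \<inter> \<Inter>\<C> \<noteq> {}"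
        using C(1)[unfolded compactin_fip, THEN conjunct2, THEN spec, of \<C>] cl by simp
      obtain D0 where D0: "D0 \<in> \<C>" using False by blast
      have D0C: "D0 \<subseteq> C" "compactin X D0"
        using D0 CA by (auto simp: A_def)
      have "closedin X (\<Inter>\<C>)"
        using False cl by (rule closedin_Inter)
      then have "compactin X (\<Inter>\<C>)"
        using D0 by (intro closed_compactin[OF D0C(2)]) auto
      moreover have "\<Inter>\<C> \<subseteq> C"
        using D0 D0C by blast
      moreover have "x \<cdot> y \<in> \<Inter>\<C>" if "x \<in> \<Inter>\<C>" "y \<in> \<Inter>\<C>" for x y
        using that CA unfolding A_def by fast
      ultimately have "\<Inter>\<C> \<in> A"
        using ne by (auto simp: A_def)
      then show ?thesis
        by (rule bexI[rotated]) (auto simp: R_def)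
    qed
  qed
  then obtain D where DA: "D \<in> A" and min: "\<And>E. E \<in> A \<Longrightarrow> E \<subseteq> D \<Longrightarrow> E = D"
    unfolding R_def by blast
  then have D: "D \<noteq> {}" "D \<subseteq> C" "compactin X D" "\<And>x y. x \<in> D \<Longrightarrow> y \<in> D \<Longrightarrow> x \<cdot> y \<in> D"
    by (auto simp: A_def)
  then have top: "D \<subseteq> topspace X"
    by (simp add: compactin_subset_topspace)
  obtain e where e: "e \<in> D" using D(1) by blast
  have "(\<lambda>x. x \<cdot> e) ` D = D"
  proof (rule min)
    have "compactin X ((\<lambda>x. x \<cdot> e) ` D)"
      using D(3) e top by (intro compactin_mult_right) auto
    moreover have "x \<cdot> e \<cdot> (y \<cdot> e) \<in> (\<lambda>x. x \<cdot> e) ` D" if "x \<in> D" "y \<in> D" for x y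
      using that D(4) e by (simp add: mult_assoc[symmetric])
    moreover show "(\<lambda>x. x \<cdot> e) ` D \<subseteq> D"
      using D(4) e by auto
    ultimately show "(\<lambda>x. x \<cdot> e) ` D \<in> A"
      using D(1,2) by (simp add: A_def)
  qed
  then obtain x where x: "x \<in> D" "x \<cdot> e = e"
    using e by (metis imageE)
  have "{x \<in> D. x \<cdot> e = e} = D"
  proof (rule min)
    have "closedin X {x \<in> topspace X. x \<cdot> e \<in> {e}}"
      using e top by (intro closedin_continuous_map_preimage[OF continuous_mult_right]
          closedin_Hausdorff_singleton[OF Hausdorff]) auto
    then have "compactin X ({x \<in> topspace X. x \<cdot> e \<in> {e}} \<inter> D)"
      using D(3) by (rule closed_Int_compactin)
    moreover have "{x \<in> topspace X. x \<cdot> e \<in> {e}} \<inter> D = {x \<in> D. x \<cdot> e = e}"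
      using top by auto
    ultimately show "{x \<in> D. x \<cdot> e = e} \<in> A"
      using x D by (auto simp: A_def mult_assoc)
  qed auto
  then show ?thesis using e D(2) by blast
qed

text \<open>Both iterated limits equal \<open>f (u \<cdot> v)\<close>, where \<open>u\<close> and \<open>v\<close> are cluster points of the two families.\<close>

lemma double_limit:
  fixes f :: "'a \<Rightarrow> 'b::topological_space"
  assumes C: "compactin X C" and f: "continuous_map X euclidean f"
    and F: "F \<noteq> bot" "\<forall>\<^sub>F i in F. x i \<in> C" and G: "G \<noteq> bot" "\<forall>\<^sub>F j in G. y j \<in> C"
    and A: "closed A" "\<forall>\<^sub>F i in F. \<forall>\<^sub>F j in G. f (x i \<cdot> y j) \<in> A"
    and B: "closed B" "\<forall>\<^sub>F j in G. \<forall>\<^sub>F i in F. f (x i \<cdot> y j) \<in> B"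
  shows "A \<inter> B \<noteq> {}"
proof -
  obtain p where p: "p \<in> ultrafilters" "p \<le> F" using ex_ultrafilter_le[OF F(1)] by blast
  obtain q where q: "q \<in> ultrafilters" "q \<le> G" using ex_ultrafilter_le[OF G(1)] by blast
  have bot: "p \<noteq> bot" "q \<noteq> bot" using p q by (auto dest: ultrafilters_not_bot)
  have top: "C \<subseteq> topspace X" using C by (rule compactin_subset_topspace)
  have xC: "\<forall>\<^sub>F i in p. x i \<in> C" and yC: "\<forall>\<^sub>F j in q. y j \<in> C"
    using F(2) G(2) p(2) q(2) by (auto intro: filter_leD)
  obtain u where u: "u \<in> C" "limitin X x u p"
    using compactin_ultrafilter_limit[OF C p(1) xC] by blast
  obtain v where v: "v \<in> C" "limitin X y v q"
    using compactin_ultrafilter_limit[OF C q(1) yC] by blast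
  have left: "((\<lambda>j. f (a \<cdot> y j)) \<longlongrightarrow> f (a \<cdot> v)) q" if "a \<in> C" for a
    using continuous_map_limitin_tendsto[OF continuous_map_compose[OF continuous_mult_left f] v(2)]
      that top by (auto simp: o_def)
  have right: "((\<lambda>i. f (x i \<cdot> b)) \<longlongrightarrow> f (u \<cdot> b)) p" if "b \<in> C" for b
    using continuous_map_limitin_tendsto[OF continuous_map_compose[OF continuous_mult_right f] u(2)]
      that top by (auto simp: o_def)
  have "\<forall>\<^sub>F i in p. \<forall>\<^sub>F j in G. f (x i \<cdot> y j) \<in> A"
    using A(2) p(2) by (rule filter_leD[rotated])
  with xC have "\<forall>\<^sub>F i in p. f (x i \<cdot> v) \<in> A"
  proof eventually_elim
    case (elim i)
    then have "\<forall>\<^sub>F j in q. f (x i \<cdot> y j) \<in> A"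
      using q(2) by (auto intro: filter_leD)
    then show ?case
      by (rule Lim_in_closed_set[OF A(1) _ bot(2) left[OF elim(1)]])
  qed
  then have "f (u \<cdot> v) \<in> A"
    by (rule Lim_in_closed_set[OF A(1) _ bot(1) right[OF v(1)]])
  moreover have "\<forall>\<^sub>F j in q. \<forall>\<^sub>F i in F. f (x i \<cdot> y j) \<in> B"
    using B(2) q(2) by (rule filter_leD[rotated])
  with yC have "\<forall>\<^sub>F j in q. f (u \<cdot> y j) \<in> B"
  proof eventually_elim
    case (elim j)
    then have "\<forall>\<^sub>F i in p. f (x i \<cdot> y j) \<in> B"
      using p(2) by (auto intro: filter_leD)
    then show ?case
      by (rule Lim_in_closed_set[OF B(1) _ bot(1) right[OF elim(1)]])
  qed
  then have "f (u \<cdot> v) \<in> B"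
    by (rule Lim_in_closed_set[OF B(1) _ bot(2) left[OF u(1)]])
  ultimately show ?thesis by blast
qed

text \<open>Ellis' theorem for compact semitopological groups. If \<open>g \<longlongrightarrow> e\<close> while \<open>inv g \<longlongrightarrow> h\<close>,
  then the set of all such \<open>h\<close> is a compact semigroup, hence contains \<open>inv h\<close>. Multiplying
  alternately by elements close to \<open>(e, h)\<close> and to \<open>(e, inv h)\<close> produces two sequences that
  violate the double limit property unless \<open>h = e\<close>.\<close>

context
  fixes K :: "'a set" and e :: 'a and i :: "'a \<Rightarrow> 'a"
  assumes K: "compactin X K"
    and mult_K: "x \<in> K \<Longrightarrow> y \<in> K \<Longrightarrow> x \<cdot> y \<in> K"
    and e_K: "e \<in> K" and e_left: "x \<in> K \<Longrightarrow> e \<cdot> x = x" and e_right: "x \<in> K \<Longrightarrow> x \<cdot> e = x"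
    and inv_K: "x \<in> K \<Longrightarrow> i x \<in> K"
    and inv_left: "x \<in> K \<Longrightarrow> i x \<cdot> x = e" and inv_right: "x \<in> K \<Longrightarrow> x \<cdot> i x = e"
begin

abbreviation (input) inversion_graph :: "('a \<times> 'a) set"
  where "inversion_graph \<equiv> (\<lambda>x. (x, i x)) ` K"

text \<open>Its points are the pairs \<open>(x, y)\<close> for which some ultrafilter on
  \<open>K\<close> tends to \<open>x\<close> while the inverses tend to \<open>y\<close>; continuity
  of inversion amounts to the graph being closed.\<close>

abbreviation (input) inversion_closure :: "('a \<times> 'a) set"
  where "inversion_closure \<equiv> prod_topology X X closure_of inversion_graph"

lemma K_topspace: "x \<in> K \<Longrightarrow> x \<in> topspace X"
  using compactin_subset_topspace[OF K] by blast

lemma inv_cancel_left: "x \<in> K \<Longrightarrow> y \<in> K \<Longrightarrow> i x \<cdot> (x \<cdot> y) = y"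
  by (simp add: mult_assoc[symmetric] inv_left e_left)

lemma cancel_inv_left: "x \<in> K \<Longrightarrow> y \<in> K \<Longrightarrow> x \<cdot> (i x \<cdot> y) = y"
  by (simp add: mult_assoc[symmetric] inv_right e_left)

lemma inv_unique:
  assumes "x \<in> K" and "y \<in> K" and "x \<cdot> y = e"
  shows "y = i x"
  using inv_cancel_left[OF assms(1,2)] assms e_right inv_K by simp

lemma inv_mult: "x \<in> K \<Longrightarrow> y \<in> K \<Longrightarrow> i (x \<cdot> y) = i y \<cdot> i x"
  by (rule inv_unique[symmetric]) (simp_all add: mult_K inv_K mult_assoc cancel_inv_left inv_right)

lemma inversion_closure_K: "inversion_closure \<subseteq> K \<times> K"
proof (rule closure_of_minimal)
  show "closedin (prod_topology X X) (K \<times> K)"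
    using compactin_imp_closedin[OF Hausdorff K] by (simp add: closedin_prod_Times_iff)
qed (auto simp: inv_K)

lemma inversion_closure_map:
  assumes "(x, y) \<in> inversion_closure" and "continuous_map X X f" and "continuous_map X X g"
    and "\<And>z. z \<in> K \<Longrightarrow> (f z, g (i z)) \<in> inversion_closure"
  shows "(f x, g y) \<in> inversion_closure"
proof -
  have "continuous_map (prod_topology X X) (prod_topology X X) (\<lambda>z. (f (fst z), g (snd z)))"
    using continuous_map_compose[OF continuous_map_fst assms(2)]
      continuous_map_compose[OF continuous_map_snd assms(3)]
    by (intro continuous_map_pairedI) (simp_all add: o_def)
  from continuous_map_image_closure_subset[OF this, of inversion_graph]
  have "(f x, g y) \<in> prod_topology X X closure_of (\<lambda>z. (f (fst z), g (snd z))) ` inversion_graph"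
    using assms(1) by force
  also have "\<dots> \<subseteq> inversion_closure"
    using assms(4) by (intro closure_of_minimal) auto
  finally show ?thesis .
qed

lemma inversion_closure_limits:
  assumes "(x, y) \<in> inversion_closure"
  shows "\<exists>p\<in>ultrafilters. (\<forall>\<^sub>F g in p. g \<in> K) \<and> limitin X (\<lambda>g. g) x p \<and> limitin X i y p"
  using closure_of_ultrafilter_limit[OF assms] by (simp add: limitin_pairwise o_def)

text \<open>Separate continuity forces two stages: translating the limit to \<open>(e, y)\<close> by
  \<open>z\<close> gives the pairs \<open>(z, i z \<cdot> y)\<close>, and then \<open>z\<close> runs
  to \<open>e\<close> with inverses tending to \<open>x\<close>.\<close>

lemma inversion_closure_mult:
  assumes "(e, x) \<in> inversion_closure" and "(e, y) \<in> inversion_closure"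
  shows "(e, x \<cdot> y) \<in> inversion_closure"
proof -
  have y: "y \<in> K"
    using assms(2) inversion_closure_K by auto
  have "(z, i z \<cdot> y) \<in> inversion_closure" if z: "z \<in> K" for z
  proof -
    have "(e \<cdot> z, i z \<cdot> y) \<in> inversion_closure"
    proof (rule inversion_closure_map[OF assms(2) continuous_mult_right continuous_mult_left])
      fix w assume "w \<in> K"
      then show "(w \<cdot> z, i z \<cdot> i w) \<in> inversion_closure"
        using z by (intro subsetD[OF closure_of_subset])
          (auto simp: inv_mult[symmetric] mult_K inv_K K_topspace)
    qed (simp_all add: K_topspace z inv_K)
    then show ?thesis using e_left z by simp
  qed
  then show ?thesis
    using y by (intro inversion_closure_map[OF assms(1) continuous_map_id[unfolded id_def] continuous_mult_right])
      (simp_all add: K_topspace)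
qed

text \<open>The slice \<open>H\<close> over \<open>e\<close> is a compact semigroup, so H h contains
  an idempotent \<open>u \<cdot> h\<close>. In a group this must be \<open>e\<close>, which makes
  \<open>u\<close> the inverse of \<open>h\<close>.\<close>

lemma inversion_closure_inv:
  assumes "(e, h) \<in> inversion_closure"
  shows "(e, i h) \<in> inversion_closure"
proof -
  define H where "H = {x \<in> topspace X. (e, x) \<in> inversion_closure}"
  have HK: "H \<subseteq> K" and h: "h \<in> H" "h \<in> K"
    using inversion_closure_K assms K_topspace by (auto simp: H_def)
  have "continuous_map X (prod_topology X X) (\<lambda>x. (e, x))"
    by (simp add: continuous_map_pairwise o_def e_K K_topspace continuous_map_id[unfolded id_def])
  then have "closedin X H"
    unfolding H_def using closedin_closure_of by (rule closedin_continuous_map_preimage)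
  then have "compactin X H"
    by (rule closed_compactin[OF K HK])
  then have "compactin X ((\<lambda>x. x \<cdot> h) ` H)"
    using h K_topspace by (intro compactin_mult_right) auto
  moreover have HH: "x \<cdot> y \<in> H" if "x \<in> H" "y \<in> H" for x y
    using that inversion_closure_mult by (auto simp: H_def mult_closed)
  have "x \<cdot> h \<cdot> (y \<cdot> h) \<in> (\<lambda>x. x \<cdot> h) ` H" if "x \<in> H" "y \<in> H" for x y
    using that HH h(1) by (simp add: mult_assoc[symmetric])
  ultimately have "\<exists>u\<in>(\<lambda>x. x \<cdot> h) ` H. u \<cdot> u = u"
    using h(1) by (intro compact_subsemigroup_has_idempotent) auto
  then obtain u where u: "u \<in> H" "u \<cdot> h \<cdot> (u \<cdot> h) = u \<cdot> h"
    by blast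
  have uK: "u \<in> K" "u \<cdot> h \<in> K"
    using u(1) HK h mult_K by auto
  then have "u \<cdot> h = e"
    using u(2) inv_cancel_left[OF uK(2) uK(2)] inv_left by simp
  then have "i u = h" "u \<cdot> h = e"
    using inv_unique[OF uK(1) h(2)] by auto
  then have "u = i h"
    using inv_unique[of h u] inv_left[OF uK(1)] uK h by simp
  then show ?thesis using u(1) by (simp add: H_def)
qed

text \<open>An element near \<open>e\<close> whose inverse is near \<open>h\<close> meets finitely
  many open conditions at once. This drives the inductive construction that follows.\<close>

lemma inversion_closure_step:
  fixes f k :: "'a \<Rightarrow> complex"
  assumes h: "(e, h) \<in> inversion_closure"
    and f: "continuous_map X euclidean f" and k: "continuous_map X euclidean k"
    and C: "finite C" "C \<subseteq> K" "\<And>x. x \<in> C \<Longrightarrow> f (h \<cdot> x) \<in> U" "open U"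
    and D: "finite D" "D \<subseteq> K" "\<And>y. y \<in> D \<Longrightarrow> k y \<in> V" "open V"
  shows "\<exists>g\<in>K. (\<forall>x\<in>C. f (i g \<cdot> x) \<in> U) \<and> (\<forall>y\<in>D. k (y \<cdot> g) \<in> V)"
proof -
  obtain p where p: "p \<in> ultrafilters" "\<forall>\<^sub>F g in p. g \<in> K" "limitin X (\<lambda>g. g) e p" "limitin X i h p"
    using inversion_closure_limits[OF h] by blast
  have "\<forall>\<^sub>F g in p. \<forall>x\<in>C. f (i g \<cdot> x) \<in> U"
  proof (rule eventually_ball_finite[OF C(1)], rule ballI)
    fix x assume x: "x \<in> C"
    have "((\<lambda>g. f (i g \<cdot> x)) \<longlongrightarrow> f (h \<cdot> x)) p"
      using continuous_map_limitin_tendsto[OF continuous_map_compose[OF continuous_mult_right f] p(4)]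
        x C(2) K_topspace by (auto simp: o_def)
    then show "\<forall>\<^sub>F g in p. f (i g \<cdot> x) \<in> U"
      using C(4) C(3)[OF x] by (rule topological_tendstoD)
  qed
  moreover have "\<forall>\<^sub>F g in p. \<forall>y\<in>D. k (y \<cdot> g) \<in> V"
  proof (rule eventually_ball_finite[OF D(1)], rule ballI)
    fix y assume y: "y \<in> D"
    then have "((\<lambda>g. k (y \<cdot> g)) \<longlongrightarrow> k (y \<cdot> e)) p"
      using continuous_map_limitin_tendsto[OF continuous_map_compose[OF continuous_mult_left k] p(3)]
        D(2) K_topspace by (auto simp: o_def)
    moreover have "k (y \<cdot> e) \<in> V"
      using y D(2,3) e_right by auto
    ultimately show "\<forall>\<^sub>F g in p. k (y \<cdot> g) \<in> V"
      using topological_tendstoD[OF _ D(4)] by blast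
  qed
  ultimately have "\<forall>\<^sub>F g in p. g \<in> K \<and> (\<forall>x\<in>C. f (i g \<cdot> x) \<in> U) \<and> (\<forall>y\<in>D. k (y \<cdot> g) \<in> V)"
    using p(2) by (intro eventually_conj)
  then show ?thesis
    using eventually_happens'[OF ultrafilters_not_bot[OF p(1)]] by blast
qed

lemma inversion_closure_trivial:
  assumes h: "(e, h) \<in> inversion_closure"
  shows "h = e"
proof (rule ccontr)
  assume "h \<noteq> e"
  have hK: "h \<in> K" using h inversion_closure_K by auto
  obtain f :: "'a \<Rightarrow> complex" where f: "continuous_map X euclidean f" "f h \<noteq> f e"
    using functionally_Hausdorff \<open>h \<noteq> e\<close> hK e_K K_topspace by blast
  \<comment> \<open>A third of the distance leaves the two closed balls of radius
    \<open>\<eta>\<close> disjoint.\<close>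
  define \<eta> where "\<eta> = dist (f h) (f e) / 3"
  have \<eta>: "\<eta> > 0" using f(2) by (simp add: \<eta>_def)
  define U V where "U = ball (f h) \<eta>" and "V = ball (f e) \<eta>"
  have UV: "open U" "open V" "f h \<in> U" "f e \<in> V"
    using \<eta> by (auto simp: U_def V_def)
  \<comment> \<open>\<open>C\<close> and \<open>D\<close> collect the elements \<open>c\<close> and
    \<open>d\<close> chosen so far, and the last entry is the newest \<open>c\<close>. The first
    condition prepares the choice of the next \<open>d\<close>; the second records that the newest
    \<open>c\<close> suits all earlier \<open>d\<close>.\<close>
  define P where "P = (\<lambda>(C, D, c). finite C \<and> finite D \<and> C \<subseteq> K \<and> D \<subseteq> K \<and> c \<in> C \<and>
    (\<forall>x\<in>C. f (h \<cdot> (i c \<cdot> x)) \<in> U) \<and> (\<forall>y\<in>D. f (i y \<cdot> c) \<in> V))"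
  define R where "R = (\<lambda>(C, D, c :: 'a) (C', D', c' :: 'a). \<exists>d. C' = insert c' C \<and> D' = insert d D \<and>
    (\<forall>x\<in>C. f (i d \<cdot> x) \<in> U))"
  have "\<exists>s. \<forall>n::nat. P (s n) \<and> R (s n) (s (Suc n))"
  proof (rule dependent_nat_choice[of "\<lambda>_. P" "\<lambda>_. R"])
    show "\<exists>x. P x"
      by (rule exI[of _ "({e}, {}, e)"]) (simp add: P_def e_K hK inv_left e_right UV)
  next
    fix s :: "'a set \<times> 'a set \<times> 'a" and n :: nat
    assume Ps: "P s"
    obtain C D c where s: "s = (C, D, c)" by (cases s)
    have fin: "finite C" "finite D" and CK: "C \<subseteq> K" and DK: "D \<subseteq> K" and c: "c \<in> C" "c \<in> K"
      and C: "\<And>x. x \<in> C \<Longrightarrow> f (h \<cdot> (i c \<cdot> x)) \<in> U" and D: "\<And>y. y \<in> D \<Longrightarrow> f (i y \<cdot> c) \<in> V"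
      using Ps by (auto simp: s P_def)
    \<comment> \<open>Close to \<open>(e, h)\<close>: for \<open>d = c \<cdot> g\<close>, the value
      of \<open>f\<close> at \<open>i d \<cdot> x\<close> follows that at
      \<open>h \<cdot> (i c \<cdot> x)\<close>, and the value at \<open>i y \<cdot> d\<close>
      follows that at \<open>i y \<cdot> c\<close>.\<close>
    have "\<exists>g\<in>K. (\<forall>x\<in>(\<lambda>x. i c \<cdot> x) ` C. f (i g \<cdot> x) \<in> U) \<and>
        (\<forall>y\<in>(\<lambda>y. i y \<cdot> c) ` D. f (y \<cdot> g) \<in> V)"
      using fin CK DK c C D UV by (intro inversion_closure_step[OF h f(1) f(1)])
        (auto intro!: mult_K inv_K)
    then obtain g where g: "g \<in> K" "\<And>x. x \<in> C \<Longrightarrow> f (i g \<cdot> (i c \<cdot> x)) \<in> U"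
      "\<And>y. y \<in> D \<Longrightarrow> f (i y \<cdot> c \<cdot> g) \<in> V"
      by blast
    define d where "d = c \<cdot> g"
    have d: "d \<in> K" and dC: "\<And>x. x \<in> C \<Longrightarrow> f (i d \<cdot> x) \<in> U" and dD: "\<And>y. y \<in> D \<Longrightarrow> f (i y \<cdot> d) \<in> V"
      using g c by (auto simp: d_def mult_K inv_mult mult_assoc)
    have "continuous_map X euclidean (\<lambda>x. f (h \<cdot> x))"
      using continuous_map_compose[OF continuous_mult_left f(1)] hK K_topspace by (simp add: o_def)
    \<comment> \<open>Close to \<open>(e, i h)\<close>: here \<open>h\<close> cancels against the
      limit of the inverses, which restores the first condition of \<open>P\<close> for the old
      elements of \<open>C\<close>.\<close>
    then have "\<exists>g\<in>K. (\<forall>x\<in>(\<lambda>x. i d \<cdot> x) ` C. f (h \<cdot> (i g \<cdot> x)) \<in> U) \<and>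
        (\<forall>y\<in>(\<lambda>y. i y \<cdot> d) ` insert d D. f (y \<cdot> g) \<in> V)"
      using fin CK DK d dC dD UV inv_left[OF d] cancel_inv_left[OF hK]
      by (intro inversion_closure_step[OF inversion_closure_inv[OF h] _ f(1)])
        (auto simp: mult_K inv_K subset_iff)
    then obtain g' where g': "g' \<in> K" "\<And>x. x \<in> C \<Longrightarrow> f (h \<cdot> (i g' \<cdot> (i d \<cdot> x))) \<in> U"
      "\<And>y. y \<in> insert d D \<Longrightarrow> f (i y \<cdot> d \<cdot> g') \<in> V"
      by blast
    define c' where "c' = d \<cdot> g'"
    have c': "c' \<in> K" using d g'(1) by (simp add: c'_def mult_K)
    have "f (h \<cdot> (i c' \<cdot> x)) \<in> U" if "x \<in> C" for x
      using g'(2)[OF that] g'(1) d by (simp add: c'_def inv_mult mult_assoc)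
    moreover have "f (h \<cdot> (i c' \<cdot> c')) \<in> U"
      using UV(3) by (simp add: inv_left[OF c'] e_right[OF hK])
    moreover have "f (i y \<cdot> c') \<in> V" if "y \<in> insert d D" for y
      using g'(3)[OF that] by (simp add: c'_def mult_assoc)
    ultimately have "P (insert c' C, insert d D, c')"
      using d c' fin CK DK by (simp add: P_def)
    moreover have "R s (insert c' C, insert d D, c')"
      using dC by (auto simp: R_def s)
    ultimately show "\<exists>s'. P s' \<and> R s s'" by blast
  qed
  then obtain s where Ps: "\<And>n. P (s n)" and Rs: "\<And>n. R (s n) (s (Suc n))"
    by blast
  define C D c where "C = (\<lambda>n. fst (s n))" and "D = (\<lambda>n. fst (snd (s n)))"
    and "c = (\<lambda>n. snd (snd (s n)))"
  have "\<forall>n. \<exists>d. C (Suc n) = insert (c (Suc n)) (C n) \<and> D (Suc n) = insert d (D n) \<and>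
      (\<forall>x\<in>C n. f (i d \<cdot> x) \<in> U)"
    using Rs by (simp add: R_def C_def D_def c_def case_prod_beta)
  then obtain d where CS: "\<And>n. C (Suc n) = insert (c (Suc n)) (C n)"
    and DS: "\<And>n. D (Suc n) = insert (d n) (D n)" and dU: "\<And>n x. x \<in> C n \<Longrightarrow> f (i (d n) \<cdot> x) \<in> U"
    by metis
  have cC: "c n \<in> C n" and CK: "C n \<subseteq> K" and DK: "D n \<subseteq> K"
    and DV: "\<And>y. y \<in> D n \<Longrightarrow> f (i y \<cdot> c n) \<in> V" for n
    using Ps[of n] by (auto simp: P_def C_def D_def c_def case_prod_beta)
  have monoC: "C m \<subseteq> C n" and monoD: "D m \<subseteq> D n" if "m \<le> n" for m n
    using lift_Suc_mono_le[of C m n] lift_Suc_mono_le[of D m n] CS DS that by blast+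
  have "cball (f e) \<eta> \<inter> cball (f h) \<eta> \<noteq> {}"
  proof (rule double_limit[OF K f(1), where x = "\<lambda>n. i (d n)" and y = c])
    show "\<forall>\<^sub>F n in sequentially. i (d n) \<in> K"
      using DS DK inv_K by (intro always_eventually) blast
    show "\<forall>\<^sub>F n in sequentially. c n \<in> K"
      using cC CK by (intro always_eventually) blast
    \<comment> \<open>For \<open>n < m\<close> the element \<open>d n\<close> lies in
      \<open>D m\<close>, which gives values near \<open>f e\<close>; for \<open>m \<le> n\<close>
      the element \<open>c m\<close> lies in \<open>C n\<close>, which gives values near
      \<open>f h\<close>.\<close>
    show "\<forall>\<^sub>F n in sequentially. \<forall>\<^sub>F m in sequentially. f (i (d n) \<cdot> c m) \<in> cball (f e) \<eta>"
    proof (rule always_eventually, rule allI)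
      fix n
      show "\<forall>\<^sub>F m in sequentially. f (i (d n) \<cdot> c m) \<in> cball (f e) \<eta>"
        using eventually_ge_at_top[of "Suc n"]
      proof eventually_elim
        case (elim m)
        then have "d n \<in> D m" using monoD DS by blast
        then show ?case using DV by (force simp: V_def)
      qed
    qed
    show "\<forall>\<^sub>F m in sequentially. \<forall>\<^sub>F n in sequentially. f (i (d n) \<cdot> c m) \<in> cball (f h) \<eta>"
    proof (rule always_eventually, rule allI)
      fix m
      show "\<forall>\<^sub>F n in sequentially. f (i (d n) \<cdot> c m) \<in> cball (f h) \<eta>"
        using eventually_ge_at_top[of m]
      proof eventually_elim
        case (elim n)
        then have "c m \<in> C n" using monoC cC by blast
        then show ?case using dU by (force simp: U_def)
      qed
    qed
  qed auto
  then obtain z where "dist (f e) z \<le> \<eta>" "dist (f h) z \<le> \<eta>" by auto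
  then have "dist (f h) (f e) \<le> 2 * \<eta>"
    using dist_triangle2[of "f h" "f e" z] by simp
  then show False
    using \<eta> by (simp add: \<eta>_def)
qed

text \<open>Translating the pair \<open>(a, b)\<close> by \<open>i a\<close> on the left and
  \<open>a\<close> on the right moves it over \<open>e\<close>, where
  \<open>inversion_closure_trivial\<close> gives \<open>b \<cdot> a = e\<close>.\<close>

theorem limit_inverse:
  assumes F: "F \<noteq> bot" "\<forall>\<^sub>F j in F. g j \<in> K"
    and a: "limitin X g a F" and b: "limitin X (\<lambda>j. i (g j)) b F"
  shows "a \<in> K" and "b = i a"
proof -
  have "limitin (prod_topology X X) (\<lambda>j. (g j, i (g j))) (a, b) F"
    using a b by (simp add: limitin_pairwise o_def)
  then have ab: "(a, b) \<in> inversion_closure"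
    using F(1) by (rule limitin_imp_closure_of) (use F(2) in \<open>auto elim: eventually_mono\<close>)
  then show aK: "a \<in> K"
    using inversion_closure_K by auto
  have bK: "b \<in> K"
    using ab inversion_closure_K by auto
  have "(i a \<cdot> a, b \<cdot> a) \<in> inversion_closure"
  proof (rule inversion_closure_map[OF ab continuous_mult_left continuous_mult_right])
    fix w assume "w \<in> K"
    then show "(i a \<cdot> w, i w \<cdot> a) \<in> inversion_closure"
      using aK inv_mult[of "i a" w] inv_unique[of "i a" a]
      by (intro subsetD[OF closure_of_subset]) (auto simp: mult_K inv_K K_topspace inv_left)
  qed (simp_all add: K_topspace aK inv_K)
  then have "b \<cdot> a = e"
    using inversion_closure_trivial inv_left aK by simp
  then have "b \<cdot> a \<cdot> i a = i a"
    using e_left inv_K aK by simp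
  then show "b = i a"
    using aK bK by (simp add: mult_assoc inv_right e_right)
qed

end

section \<open>The smallest ideal of a compact semigroup with a unique minimal idempotent\<close>

context
  fixes S :: "'a set" and Q :: 'a
  assumes S: "compactin X S" "S \<noteq> {}" and mult_S: "x \<in> S \<Longrightarrow> y \<in> S \<Longrightarrow> x \<cdot> y \<in> S"
    and Q: "Q \<in> smallest_ideal S (\<cdot>)" "Q \<cdot> Q = Q"
    and Q_unique: "u \<in> smallest_ideal S (\<cdot>) \<Longrightarrow> u \<cdot> u = u \<Longrightarrow> u = Q"
begin

text \<open>An intersection of ideals can fail to be an ideal only by being empty, and
  \<open>Q\<close> lies in it.\<close>

lemma two_sided_ideal_smallest: "two_sided_ideal S (\<cdot>) (smallest_ideal S (\<cdot>))"
proof -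
  have "two_sided_ideal S (\<cdot>) S"
    using S(2) by (simp add: two_sided_ideal_def mult_S)
  then have "smallest_ideal S (\<cdot>) \<subseteq> S"
    by (auto simp: smallest_ideal_def)
  moreover have "a \<cdot> x \<in> smallest_ideal S (\<cdot>) \<and> x \<cdot> a \<in> smallest_ideal S (\<cdot>)"
    if "a \<in> S" "x \<in> smallest_ideal S (\<cdot>)" for a x
    using that by (simp add: smallest_ideal_def) (simp add: two_sided_ideal_def)
  ultimately show ?thesis
    using Q(1) by (auto simp: two_sided_ideal_def)
qed

lemma smallest_ideal_subset: "k \<in> smallest_ideal S (\<cdot>) \<Longrightarrow> k \<in> S"
  and mult_ideal_right: "u \<in> S \<Longrightarrow> k \<in> smallest_ideal S (\<cdot>) \<Longrightarrow> u \<cdot> k \<in> smallest_ideal S (\<cdot>)"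
  and mult_ideal_left: "u \<in> S \<Longrightarrow> k \<in> smallest_ideal S (\<cdot>) \<Longrightarrow> k \<cdot> u \<in> smallest_ideal S (\<cdot>)"
  using two_sided_ideal_smallest by (auto simp: two_sided_ideal_def)

lemma Q_S: "Q \<in> S"
  using Q(1) by (rule smallest_ideal_subset)

text \<open>The compact subsemigroup S k contains an idempotent. It lies in the smallest ideal
  because \<open>k\<close> does, so uniqueness identifies it with \<open>Q\<close>.\<close>

lemma ex_left_inverse:
  assumes k: "k \<in> smallest_ideal S (\<cdot>)"
  shows "\<exists>v\<in>S. v \<cdot> k = Q"
proof -
  have "\<exists>u\<in>(\<lambda>x. x \<cdot> k) ` S. u \<cdot> u = u"
  proof (rule compact_subsemigroup_has_idempotent)
    show "compactin X ((\<lambda>x. x \<cdot> k) ` S)"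
      using S(1) compactin_subset_topspace[OF S(1)] smallest_ideal_subset[OF k]
      by (intro compactin_mult_right) auto
    fix x y assume xy: "x \<in> (\<lambda>x. x \<cdot> k) ` S" "y \<in> (\<lambda>x. x \<cdot> k) ` S"
    then obtain a b where "a \<in> S" "b \<in> S" "x \<cdot> y = (a \<cdot> k \<cdot> b) \<cdot> k"
      by (auto simp: mult_assoc)
    then show "x \<cdot> y \<in> (\<lambda>x. x \<cdot> k) ` S"
      using smallest_ideal_subset[OF k] mult_S by auto
  qed (use Q_S in blast)
  then obtain v where v: "v \<in> S" "v \<cdot> k \<cdot> (v \<cdot> k) = v \<cdot> k" by blast
  then show ?thesis
    using Q_unique mult_ideal_right k by blast
qed

text \<open>Uniqueness is used twice: a left inverse \<open>v\<close> of \<open>w \<cdot> Q\<close>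
  makes \<open>w \<cdot> Q \<cdot> v\<close> an idempotent of the ideal, and a left inverse
  \<open>v\<close> of \<open>Q \<cdot> u\<close> does the same for
  \<open>u \<cdot> (v \<cdot> Q)\<close>, with the help of the first identity.\<close>

lemma Q_central:
  assumes u: "u \<in> S"
  shows "Q \<cdot> u = u \<cdot> Q"
proof -
  have QwQ: "Q \<cdot> (w \<cdot> Q) = w \<cdot> Q" if w: "w \<in> S" for w
  proof -
    have wQ: "w \<cdot> Q \<in> smallest_ideal S (\<cdot>)"
      using w Q by (intro mult_ideal_right)
    obtain v where v: "v \<in> S" "v \<cdot> (w \<cdot> Q) = Q"
      using ex_left_inverse[OF wQ] by blast
    have "w \<cdot> Q \<cdot> v = Q"
    proof (rule Q_unique)
      show "w \<cdot> Q \<cdot> v \<in> smallest_ideal S (\<cdot>)"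
        using v(1) wQ by (rule mult_ideal_left)
      have "w \<cdot> Q \<cdot> v \<cdot> (w \<cdot> Q \<cdot> v) = w \<cdot> Q \<cdot> (v \<cdot> (w \<cdot> Q)) \<cdot> v"
        by (simp add: mult_assoc)
      also have "\<dots> = w \<cdot> (Q \<cdot> Q) \<cdot> v"
        unfolding v(2) by (simp add: mult_assoc)
      finally show "w \<cdot> Q \<cdot> v \<cdot> (w \<cdot> Q \<cdot> v) = w \<cdot> Q \<cdot> v"
        by (simp add: Q(2))
    qed
    then have "Q \<cdot> (w \<cdot> Q) = w \<cdot> Q \<cdot> (v \<cdot> (w \<cdot> Q))"
      by (simp add: mult_assoc[symmetric])
    then show ?thesis
      by (simp add: v(2) mult_assoc Q(2))
  qed
  obtain v where v: "v \<in> S" "v \<cdot> (Q \<cdot> u) = Q"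
    using ex_left_inverse[OF mult_ideal_left[OF u Q(1)]] by blast
  have "u \<cdot> (v \<cdot> Q) = Q"
  proof (rule Q_unique)
    show "u \<cdot> (v \<cdot> Q) \<in> smallest_ideal S (\<cdot>)"
      using u v Q by (intro mult_ideal_right)
    have "u \<cdot> (v \<cdot> Q) \<cdot> (u \<cdot> (v \<cdot> Q)) = u \<cdot> (v \<cdot> (Q \<cdot> u)) \<cdot> (v \<cdot> Q)"
      by (simp add: mult_assoc)
    also have "\<dots> = u \<cdot> (v \<cdot> Q)"
      unfolding v(2) using QwQ[OF v(1)] by (simp add: mult_assoc)
    finally show "u \<cdot> (v \<cdot> Q) \<cdot> (u \<cdot> (v \<cdot> Q)) = u \<cdot> (v \<cdot> Q)" .
  qed
  then have "Q \<cdot> u = u \<cdot> (v \<cdot> (Q \<cdot> u))"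
    by (simp add: mult_assoc[symmetric])
  then show ?thesis by (simp add: v(2))
qed

text \<open>Centrality of \<open>Q\<close> makes the right-hand side an ideal, so it contains the
  smallest one; conversely \<open>u = u \<cdot> Q\<close> lies in the smallest ideal together with
  \<open>Q\<close>.\<close>

lemma smallest_ideal_eq: "smallest_ideal S (\<cdot>) = {u \<in> S. u \<cdot> Q = u}"
proof (intro equalityI subsetI)
  fix k assume k: "k \<in> smallest_ideal S (\<cdot>)"
  have "two_sided_ideal S (\<cdot>) {u \<in> S. u \<cdot> Q = u}"
    unfolding two_sided_ideal_def
  proof (intro conjI ballI)
    show "{u \<in> S. u \<cdot> Q = u} \<noteq> {}" using Q_S Q(2) by blast
    fix a x assume a: "a \<in> S" and x: "x \<in> {u \<in> S. u \<cdot> Q = u}"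
    then show "a \<cdot> x \<in> {u \<in> S. u \<cdot> Q = u}"
      by (simp add: mult_S mult_assoc)
    have "x \<cdot> a \<cdot> Q = x \<cdot> Q \<cdot> a"
      by (simp add: mult_assoc Q_central[OF a])
    then show "x \<cdot> a \<in> {u \<in> S. u \<cdot> Q = u}"
      using a x by (simp add: mult_S)
  qed blast
  with k show "k \<in> {u \<in> S. u \<cdot> Q = u}"
    by (auto simp: smallest_ideal_def)
next
  fix k assume "k \<in> {u \<in> S. u \<cdot> Q = u}"
  then show "k \<in> smallest_ideal S (\<cdot>)"
    using mult_ideal_right[OF _ Q(1), of k] by auto
qed

text \<open>Left inverses relative to the identity \<open>Q\<close> exist throughout the ideal; as
  in any group, the left inverse \<open>m\<close> of \<open>l\<close> coincides with
  \<open>k\<close>.\<close>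

lemma ex_inverse:
  assumes k: "k \<in> smallest_ideal S (\<cdot>)"
  shows "\<exists>l\<in>smallest_ideal S (\<cdot>). l \<cdot> k = Q \<and> k \<cdot> l = Q"
proof -
  have left: "\<exists>l\<in>smallest_ideal S (\<cdot>). l \<cdot> k = Q" if k: "k \<in> smallest_ideal S (\<cdot>)" for k
  proof -
    obtain v where "v \<in> S" "v \<cdot> k = Q" using ex_left_inverse[OF k] by blast
    then have "v \<cdot> Q \<in> smallest_ideal S (\<cdot>)" "v \<cdot> Q \<cdot> k = Q"
      using mult_ideal_right[OF _ Q(1)] k Q_central[OF smallest_ideal_subset[OF k]]
      by (simp_all add: mult_assoc smallest_ideal_eq)
    then show ?thesis by blast
  qed
  obtain l where l: "l \<in> smallest_ideal S (\<cdot>)" "l \<cdot> k = Q" using left[OF k] by blast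
  obtain m where m: "m \<in> smallest_ideal S (\<cdot>)" "m \<cdot> l = Q" using left[OF l(1)] by blast
  have "m = m \<cdot> (l \<cdot> k)" using m(1) l(2) by (simp add: smallest_ideal_eq)
  also have "\<dots> = Q \<cdot> k" using m(2) by (simp add: mult_assoc[symmetric])
  also have "\<dots> = k" using k Q_central[of k] by (simp add: smallest_ideal_eq)
  finally show ?thesis using l m by blast
qed

lemma compactin_smallest_ideal: "compactin X (smallest_ideal S (\<cdot>))"
proof -
  have "smallest_ideal S (\<cdot>) = (\<lambda>x. x \<cdot> Q) ` S"
    unfolding smallest_ideal_eq
  proof (intro equalityI subsetI)
    fix k assume "k \<in> {u \<in> S. u \<cdot> Q = u}"
    then show "k \<in> (\<lambda>x. x \<cdot> Q) ` S" by (metis (mono_tags) image_eqI mem_Collect_eq)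
  qed (auto simp: mult_S Q_S mult_assoc Q(2))
  then show ?thesis
    using S(1) Q_S compactin_subset_topspace[OF S(1)] by (auto intro: compactin_mult_right)
qed

end

end

section \<open>The weak operator topology\<close>

lemma bounded_clinear_compose:
  "bounded_clinear f \<Longrightarrow> bounded_clinear g \<Longrightarrow> bounded_clinear (f \<circ> g)"
  unfolding bounded_clinear_def by (auto simp: o_def intro: bounded_linear_compose)

lemma bounded_operators_comp:
  "S \<in> bounded_operators \<Longrightarrow> T \<in> bounded_operators \<Longrightarrow> S \<circ> T \<in> bounded_operators"
  by (simp add: bounded_operators_def bounded_clinear_compose)

lemma bounded_operators_bounded_linear: "T \<in> bounded_operators \<Longrightarrow> bounded_linear T"
  by (simp add: bounded_operators_def bounded_clinear_def)

lemma continuous_map_weak_operator_functional: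
  fixes \<phi> :: "'e::complex_banach \<Rightarrow> complex"
  assumes "bounded_clinear \<phi>"
  shows "continuous_map weak_operator_topology euclidean (\<lambda>T. \<phi> (T \<xi>))"
  unfolding continuous_map_def
proof (intro conjI allI impI)
  fix U :: "complex set" assume "openin euclidean U"
  then show "openin weak_operator_topology {T \<in> topspace weak_operator_topology. \<phi> (T \<xi>) \<in> U}"
    unfolding topspace_weak_operator_topology unfolding weak_operator_topology_def
    using assms by (intro topology_generated_by_Basis) auto
qed simp

lemma continuous_map_into_weak_operator_topology:
  fixes F :: "'a \<Rightarrow> ('e::complex_banach \<Rightarrow> 'e)"
  assumes "\<And>x. x \<in> topspace Y \<Longrightarrow> F x \<in> bounded_operators"
    and "\<And>\<phi> \<xi>. bounded_clinear (\<phi> :: 'e \<Rightarrow> complex) \<Longrightarrow> continuous_map Y euclidean (\<lambda>x. \<phi> (F x \<xi>))"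
  shows "continuous_map Y weak_operator_topology F"
  unfolding weak_operator_topology_def
proof (rule continuous_on_generated_topo)
  fix W
  assume "W \<in> {{T \<in> bounded_operators. \<phi> (T \<xi>) \<in> U} | (\<phi> :: 'e \<Rightarrow> complex) \<xi> U.
       bounded_clinear \<phi> \<and> open U}"
  then obtain \<phi> :: "'e \<Rightarrow> complex" and \<xi> U where
    W: "W = {T \<in> bounded_operators. \<phi> (T \<xi>) \<in> U}" "bounded_clinear \<phi>" "open U"
    by blast
  have "F -` W \<inter> topspace Y = {x \<in> topspace Y. \<phi> (F x \<xi>) \<in> U}"
    using assms(1) by (auto simp: W(1))
  then show "openin Y (F -` W \<inter> topspace Y)"
    using openin_continuous_map_preimage[OF assms(2)[OF W(2)], of U] W(3) by simp
next
  have "bounded_operators \<subseteq> topspace (weak_operator_topology :: ('e \<Rightarrow> 'e) topology)"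
    by (simp add: topspace_weak_operator_topology)
  then show "F ` topspace Y \<subseteq> \<Union> {{T \<in> bounded_operators. \<phi> (T \<xi>) \<in> U} | (\<phi> :: 'e \<Rightarrow> complex) \<xi> U.
       bounded_clinear \<phi> \<and> open U}"
    using assms(1) unfolding weak_operator_topology_def topology_generated_by_topspace by blast
qed

lemma eq_if_functionals_eq:
  fixes x y :: "'e::complex_banach"
  assumes "\<And>\<phi> :: 'e \<Rightarrow> complex. bounded_clinear \<phi> \<Longrightarrow> \<phi> x = \<phi> y"
  shows "x = y"
proof (rule ccontr)
  assume "x \<noteq> y"
  then obtain \<phi> :: "'e \<Rightarrow> complex" where \<phi>: "bounded_clinear \<phi>" "\<phi> (x - y) \<noteq> 0"
    using ex_bounded_clinear_functional[of "x - y"] by auto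
  then have "\<phi> (x - y) = \<phi> x - \<phi> y"
    by (intro linear_diff bounded_linear.linear) (simp add: bounded_clinear_def)
  with \<phi> assms[OF \<phi>(1)] show False by simp
qed

text \<open>Composing with \<open>S\<close> on the left replaces \<phi> by
  \<open>\<phi> \<circ> S\<close>, composing on the right replaces \<xi> by \<open>S \<xi>\<close>;
  both stay within the family of functions defining the topology.\<close>

interpretation wot: semitopological_semigroup
  "weak_operator_topology :: ('e::complex_banach \<Rightarrow> 'e) topology" "(\<circ>)"
proof
  fix S T :: "'e \<Rightarrow> 'e"
  assume "S \<in> topspace weak_operator_topology" "T \<in> topspace weak_operator_topology"
  then show "S \<circ> T \<in> topspace weak_operator_topology"
    by (simp add: topspace_weak_operator_topology bounded_operators_comp)
next
  fix S :: "'e \<Rightarrow> 'e"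
  assume S: "S \<in> topspace weak_operator_topology"
  show "continuous_map weak_operator_topology weak_operator_topology (\<lambda>T. S \<circ> T)"
  proof (rule continuous_map_into_weak_operator_topology)
    fix \<phi> :: "'e \<Rightarrow> complex" and \<xi> assume "bounded_clinear \<phi>"
    then have "bounded_clinear (\<phi> \<circ> S)"
      using S by (simp add: topspace_weak_operator_topology bounded_operators_def bounded_clinear_compose)
    from continuous_map_weak_operator_functional[OF this]
    show "continuous_map weak_operator_topology euclidean (\<lambda>T. \<phi> ((S \<circ> T) \<xi>))"
      by (simp add: o_def)
  qed (use S in \<open>simp add: topspace_weak_operator_topology bounded_operators_comp\<close>)
  show "continuous_map weak_operator_topology weak_operator_topology (\<lambda>T. T \<circ> S)"
  proof (rule continuous_map_into_weak_operator_topology)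
    fix \<phi> :: "'e \<Rightarrow> complex" and \<xi> assume "bounded_clinear \<phi>"
    from continuous_map_weak_operator_functional[OF this]
    show "continuous_map weak_operator_topology euclidean (\<lambda>T. \<phi> ((T \<circ> S) \<xi>))"
      by (simp add: o_def)
  qed (use S in \<open>simp add: topspace_weak_operator_topology bounded_operators_comp\<close>)
next
  fix S T :: "'e \<Rightarrow> 'e"
  assume "S \<noteq> T"
  then obtain \<xi> where "S \<xi> \<noteq> T \<xi>" by auto
  then obtain \<phi> :: "'e \<Rightarrow> complex" where "bounded_clinear \<phi>" "\<phi> (S \<xi>) \<noteq> \<phi> (T \<xi>)"
    using eq_if_functionals_eq by blast
  then show "\<exists>f :: ('e \<Rightarrow> 'e) \<Rightarrow> complex. continuous_map weak_operator_topology euclidean f \<and> f S \<noteq> f T"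
    using continuous_map_weak_operator_functional[of \<phi> \<xi>] by (intro exI[of _ "\<lambda>T. \<phi> (T \<xi>)"]) simp
qed (simp add: o_assoc)

lemma limitin_weak_operator_functional:
  fixes \<phi> :: "'e::complex_banach \<Rightarrow> complex"
  assumes "limitin weak_operator_topology f T F" and "bounded_clinear \<phi>"
  shows "((\<lambda>i. \<phi> (f i \<xi>)) \<longlongrightarrow> \<phi> (T \<xi>)) F"
  using continuous_map_limitin_tendsto[OF continuous_map_weak_operator_functional[OF assms(2)] assms(1)] .

section \<open>Representations with a unique minimal idempotent\<close>

text \<open>The inner filter may depend on the outer point: it is constant for products of
  ultrafilters, and s^{-1} q in the treatment of q^{-1} q.\<close>

lemma tendsto_of_iterated:
  fixes g :: "'a \<Rightarrow> 'b \<Rightarrow> 'c::metric_space"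
  assumes close: "\<And>\<epsilon>. \<epsilon> > 0 \<Longrightarrow> \<forall>\<^sub>F s in F. \<forall>\<^sub>F t in G s. dist (g s t) c < \<epsilon>"
    and lim: "\<forall>\<^sub>F s in F. G s \<noteq> bot \<and> (g s \<longlongrightarrow> l s) (G s)"
  shows "(l \<longlongrightarrow> c) F"
proof (rule tendstoI)
  fix \<epsilon> :: real assume "\<epsilon> > 0"
  then have "\<forall>\<^sub>F s in F. \<forall>\<^sub>F t in G s. dist (g s t) c < \<epsilon> / 2"
    by (intro close) simp
  then show "\<forall>\<^sub>F s in F. dist (l s) c < \<epsilon>"
    using lim
  proof eventually_elim
    case (elim s)
    then have "\<forall>\<^sub>F t in G s. g s t \<in> cball c (\<epsilon> / 2)"
      by (auto elim!: eventually_mono simp: dist_commute)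
    then have "l s \<in> cball c (\<epsilon> / 2)"
      using elim(2) by (intro Lim_in_closed_set[OF closed_cball]) auto
    then show ?case using \<open>\<epsilon> > 0\<close> by (simp add: dist_commute)
  qed
qed

lemma representation_in_wot_hull:
  assumes "representation \<pi>"
  shows "\<pi> s \<in> wot_hull \<pi>"
  unfolding wot_hull_def
  using assms by (intro subsetD[OF closure_of_subset])
    (auto simp: topspace_weak_operator_topology representation_def)

text \<open>Two closure steps, one factor at a time: translation by \<open>\<pi> s\<close> preserves
  the range of \<pi>, hence the hull; therefore right translation by \<open>v\<close> maps the
  range, and then its closure, into the hull.\<close>

lemma wot_hull_comp:
  fixes \<pi> :: "'s::semigroup_mult \<Rightarrow> 'e::complex_banach \<Rightarrow> 'e"
  assumes \<pi>: "representation \<pi>" and u: "u \<in> wot_hull \<pi>" and v: "v \<in> wot_hull \<pi>"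
  shows "u \<circ> v \<in> wot_hull \<pi>"
proof -
  have top: "w \<in> topspace weak_operator_topology" if "w \<in> wot_hull \<pi>" for w
    using that subsetD[OF closure_of_subset_topspace] unfolding wot_hull_def by fast
  have 1: "\<pi> s \<circ> w \<in> wot_hull \<pi>" if w: "w \<in> wot_hull \<pi>" for s w
  proof -
    have "\<pi> s \<circ> w \<in> (\<lambda>x. \<pi> s \<circ> x) ` wot_hull \<pi>"
      using w by (rule imageI)
    also have "\<dots> \<subseteq> weak_operator_topology closure_of ((\<lambda>x. \<pi> s \<circ> x) ` range \<pi>)"
      unfolding wot_hull_def
      by (rule continuous_map_image_closure_subset[OF wot.continuous_mult_left])
        (rule top[OF representation_in_wot_hull[OF \<pi>]])
    also have "\<dots> \<subseteq> wot_hull \<pi>"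
    proof -
      have "\<pi> s \<circ> \<pi> t = \<pi> (s * t)" for t
        using \<pi> by (simp add: representation_def)
      then show ?thesis
        unfolding wot_hull_def by (intro closure_of_mono) auto
    qed
    finally show ?thesis .
  qed
  have "u \<circ> v \<in> (\<lambda>x. x \<circ> v) ` wot_hull \<pi>"
    using u by (rule imageI)
  also have "\<dots> \<subseteq> weak_operator_topology closure_of ((\<lambda>x. x \<circ> v) ` range \<pi>)"
    unfolding wot_hull_def
    by (rule continuous_map_image_closure_subset[OF wot.continuous_mult_right]) (rule top[OF v])
  also have "\<dots> \<subseteq> wot_hull \<pi>"
    unfolding wot_hull_def
    by (rule closure_of_minimal) (use 1[OF v] in \<open>auto simp: wot_hull_def\<close>)
  finally show ?thesis .
qed

locale JdLG_representation =
  fixes \<pi> :: "'s::semigroup_mult \<Rightarrow> 'e::complex_banach \<Rightarrow> 'e"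
  assumes admissible: "JdLG_admissible \<pi>"
begin

abbreviation enveloping :: "('e \<Rightarrow> 'e) set"
  where "enveloping \<equiv> wot_hull \<pi>"

abbreviation min_ideal :: "('e \<Rightarrow> 'e) set"
  where "min_ideal \<equiv> smallest_ideal enveloping (\<circ>)"

definition Q :: "'e \<Rightarrow> 'e"
  where "Q = (THE u. u \<in> min_ideal \<and> u \<circ> u = u)"

lemma representation: "representation \<pi>"
  and compact_enveloping: "compactin weak_operator_topology enveloping"
  using admissible by (auto simp: JdLG_admissible_def)

lemma \<pi>_mult: "\<pi> (s * t) = \<pi> s \<circ> \<pi> t"
  using representation by (simp add: representation_def)

lemma \<pi>_enveloping: "\<pi> s \<in> enveloping"
  by (rule representation_in_wot_hull[OF representation])

lemma enveloping_comp: "u \<in> enveloping \<Longrightarrow> v \<in> enveloping \<Longrightarrow> u \<circ> v \<in> enveloping"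
  by (rule wot_hull_comp[OF representation])

lemma enveloping_bounded: "u \<in> enveloping \<Longrightarrow> u \<in> bounded_operators"
  using compactin_subset_topspace[OF compact_enveloping] by (auto simp: topspace_weak_operator_topology)

lemma enveloping_linear: "u \<in> enveloping \<Longrightarrow> linear u"
  by (rule bounded_linear.linear[OF bounded_operators_bounded_linear[OF enveloping_bounded]])

lemma functional_enveloping: "bounded_clinear \<phi> \<Longrightarrow> u \<in> enveloping \<Longrightarrow> bounded_clinear (\<phi> \<circ> u)"
  using enveloping_bounded by (auto simp: bounded_operators_def intro: bounded_clinear_compose)

lemma Q_min_ideal: "Q \<in> min_ideal" and Q_idem: "Q \<circ> Q = Q"
proof -
  have "\<exists>!u. u \<in> min_ideal \<and> u \<circ> u = u"
    using admissible by (simp add: JdLG_admissible_def)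
  from theI'[OF this] show "Q \<in> min_ideal" "Q \<circ> Q = Q"
    by (simp_all add: Q_def)
qed

lemma Q_unique: "u \<in> min_ideal \<Longrightarrow> u \<circ> u = u \<Longrightarrow> u = Q"
  using admissible Q_min_ideal Q_idem unfolding JdLG_admissible_def by blast

lemma enveloping_nonempty: "enveloping \<noteq> {}"
  using \<pi>_enveloping by blast

lemmas enveloping_facts = compact_enveloping enveloping_nonempty enveloping_comp Q_min_ideal Q_idem Q_unique

lemma min_ideal_eq: "min_ideal = {u \<in> enveloping. u \<circ> Q = u}"
  by (rule wot.smallest_ideal_eq[OF enveloping_facts])

lemma Q_central: "u \<in> enveloping \<Longrightarrow> Q \<circ> u = u \<circ> Q"
  by (rule wot.Q_central[OF enveloping_facts])

lemma min_ideal_enveloping: "k \<in> min_ideal \<Longrightarrow> k \<in> enveloping"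
  by (simp add: min_ideal_eq)

lemma Q_enveloping: "Q \<in> enveloping"
  by (rule min_ideal_enveloping[OF Q_min_ideal])

lemma min_ideal_left_inverse: "k \<in> min_ideal \<Longrightarrow> \<exists>v\<in>enveloping. v \<circ> k = Q"
  by (rule wot.ex_left_inverse[OF enveloping_facts])

lemma min_ideal_comp:
  assumes "u \<in> enveloping" and "k \<in> min_ideal"
  shows "u \<circ> k \<in> min_ideal" and "k \<circ> u \<in> min_ideal"
proof -
  show "u \<circ> k \<in> min_ideal"
    by (rule wot.mult_ideal_right[OF enveloping_facts assms])
  show "k \<circ> u \<in> min_ideal"
    by (rule wot.mult_ideal_left[OF enveloping_facts assms])
qed

lemma min_ideal_comp_Q: "k \<in> min_ideal \<Longrightarrow> k \<circ> Q = k"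
  unfolding min_ideal_eq by blast

lemma Q_comp_min_ideal: "k \<in> min_ideal \<Longrightarrow> Q \<circ> k = k"
  by (rule trans[OF Q_central[OF min_ideal_enveloping] min_ideal_comp_Q])

text \<open>A left inverse of \<open>u \<circ> Q\<close> modulo \<open>Q\<close> undoes
  \<open>u\<close> on the range of \<open>Q\<close>, and one of \<open>Q \<circ> u\<close> recovers
  \<open>Q \<xi>\<close> from \<open>u \<xi>\<close>. The converse inclusions take
  \<open>u = Q\<close>, with centrality for \<open>E_r\<close>.\<close>

lemma JdLG_projection_eq: "JdLG_projection \<pi> = Q"
proof -
  have "range Q = E_r \<pi>"
  proof (intro equalityI subsetI)
    fix \<xi> assume "\<xi> \<in> range Q"
    then have Q\<xi>: "Q \<xi> = \<xi>" using Q_idem by (metis comp_apply imageE)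
    have "\<exists>v\<in>enveloping. v (u \<xi>) = \<xi>" if u: "u \<in> enveloping" for u
    proof -
      obtain v where v: "v \<in> enveloping" "v \<circ> (u \<circ> Q) = Q"
        using min_ideal_left_inverse[OF min_ideal_comp(1)[OF u Q_min_ideal]] by blast
      then have "v (u \<xi>) = \<xi>" using Q\<xi> by (metis comp_apply)
      then show ?thesis using v(1) by blast
    qed
    then show "\<xi> \<in> E_r \<pi>" by (simp add: E_r_def)
  next
    fix \<xi> assume "\<xi> \<in> E_r \<pi>"
    then obtain v where v: "v \<in> enveloping" "v (Q \<xi>) = \<xi>"
      using Q_enveloping by (auto simp: E_r_def)
    then have "Q (v \<xi>) = \<xi>" using Q_central[OF v(1)] by (metis comp_apply)
    then show "\<xi> \<in> range Q" by (metis rangeI)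
  qed
  moreover have "{\<xi>. Q \<xi> = 0} = E_aws \<pi>"
  proof (intro equalityI subsetI)
    fix \<xi> assume "\<xi> \<in> E_aws \<pi>"
    then obtain u where u: "u \<in> enveloping" "u \<xi> = 0" by (auto simp: E_aws_def)
    obtain v where v: "v \<in> enveloping" "v \<circ> (Q \<circ> u) = Q"
      using min_ideal_left_inverse[OF min_ideal_comp(2)[OF u(1) Q_min_ideal]] by blast
    have "Q \<xi> = v (Q (u \<xi>))" using v(2) by (metis comp_apply)
    then show "\<xi> \<in> {\<xi>. Q \<xi> = 0}"
      using u(2) v(1) enveloping_linear Q_enveloping by (simp add: linear_0)
  qed (use Q_enveloping in \<open>auto simp: E_aws_def\<close>)
  ultimately have "is_JdLG_projection \<pi> Q"
    using Q_idem enveloping_bounded[OF Q_enveloping] by (simp add: is_JdLG_projection_def)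
  then show ?thesis
    unfolding JdLG_projection_def
    by (intro the_equality) (auto intro: is_JdLG_projection_unique)
qed

subsection \<open>The operators \<open>p-lim \<pi>\<close>\<close>

definition plim :: "'s filter \<Rightarrow> 'e \<Rightarrow> 'e"
  where "plim p = (SOME T. T \<in> enveloping \<and> limitin weak_operator_topology \<pi> T p)"

lemma plim_enveloping: "p \<in> ultrafilters \<Longrightarrow> plim p \<in> enveloping"
  and limitin_plim: "p \<in> ultrafilters \<Longrightarrow> limitin weak_operator_topology \<pi> (plim p) p"
proof -
  assume p: "p \<in> ultrafilters"
  have "\<forall>\<^sub>F s in p. \<pi> s \<in> enveloping"
    by (simp add: \<pi>_enveloping)
  from compactin_ultrafilter_limit[OF compact_enveloping p this]
  have "\<exists>T. T \<in> enveloping \<and> limitin weak_operator_topology \<pi> T p"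
    by (simp only: Bex_def)
  from someI_ex[OF this]
  show "plim p \<in> enveloping" "limitin weak_operator_topology \<pi> (plim p) p"
    unfolding plim_def by (rule conjunct1, rule conjunct2)
qed

lemma plim_functional:
  fixes \<phi> :: "'e \<Rightarrow> complex"
  assumes "p \<in> ultrafilters" and "bounded_clinear \<phi>"
  shows "((\<lambda>s. \<phi> (\<pi> s \<xi>)) \<longlongrightarrow> \<phi> (plim p \<xi>)) p"
  by (rule limitin_weak_operator_functional[OF limitin_plim[OF assms(1)] assms(2)])

lemma plim_functional_\<pi>:
  fixes \<phi> :: "'e \<Rightarrow> complex"
  assumes "p \<in> ultrafilters" and "bounded_clinear \<phi>"
  shows "((\<lambda>t. \<phi> (\<pi> s (\<pi> t \<xi>))) \<longlongrightarrow> \<phi> (\<pi> s (plim p \<xi>))) p"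
  using plim_functional[OF assms(1) functional_enveloping[OF assms(2) \<pi>_enveloping[of s]]] by simp

lemma plim_eqI:
  assumes "p \<in> ultrafilters" and "limitin weak_operator_topology \<pi> T p"
  shows "plim p = T"
  using limitin_Hausdorff_unique[OF limitin_plim[OF assms(1)] assms(2)]
    ultrafilters_not_bot[OF assms(1)] wot.Hausdorff by blast

lemma ex_plim_eq:
  assumes "u \<in> enveloping"
  shows "\<exists>p\<in>ultrafilters. plim p = u"
  using closure_of_ultrafilter_limit[of u weak_operator_topology \<pi> UNIV] assms plim_eqI
  unfolding wot_hull_def by blast

text \<open>A limit along the product unfolds into an iterated one, first in \<open>t\<close> along
  \<open>p\<close>, then in \<open>s\<close> along \<open>q\<close>; the inner limit passes through
  \<open>\<pi> s\<close> because \<open>\<phi> \<circ> \<pi> s\<close> is again a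
  functional.\<close>

lemma plim_uf_mult:
  assumes p: "p \<in> ultrafilters" and q: "q \<in> ultrafilters"
  shows "plim (uf_mult (*) q p) = plim q \<circ> plim p"
proof (rule ext, rule eq_if_functionals_eq)
  fix \<xi> and \<phi> :: "'e \<Rightarrow> complex" assume \<phi>: "bounded_clinear \<phi>"
  note qp = uf_mult_ultrafilters[OF p q, of "(*)"]
  have "((\<lambda>s. \<phi> (\<pi> s (plim p \<xi>))) \<longlongrightarrow> \<phi> (plim (uf_mult (*) q p) \<xi>)) q"
  proof (rule tendsto_of_iterated[where G = "\<lambda>_. p" and g = "\<lambda>s t. \<phi> (\<pi> s (\<pi> t \<xi>))"])
    fix \<epsilon> :: real assume "\<epsilon> > 0"
    from tendstoD[OF plim_functional[OF qp \<phi>, of \<xi>] this]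
    show "\<forall>\<^sub>F s in q. \<forall>\<^sub>F t in p. dist (\<phi> (\<pi> s (\<pi> t \<xi>))) (\<phi> (plim (uf_mult (*) q p) \<xi>)) < \<epsilon>"
      by (simp add: eventually_uf_mult \<pi>_mult)
  next
    show "\<forall>\<^sub>F s in q. p \<noteq> bot \<and> ((\<lambda>t. \<phi> (\<pi> s (\<pi> t \<xi>))) \<longlongrightarrow> \<phi> (\<pi> s (plim p \<xi>))) p"
      using plim_functional_\<pi>[OF p \<phi>] ultrafilters_not_bot[OF p] by simp
  qed
  moreover have "((\<lambda>s. \<phi> (\<pi> s (plim p \<xi>))) \<longlongrightarrow> \<phi> (plim q (plim p \<xi>))) q"
    by (rule plim_functional[OF q \<phi>])
  ultimately show "\<phi> (plim (uf_mult (*) q p) \<xi>) = \<phi> ((plim q \<circ> plim p) \<xi>)"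
    using tendsto_unique[OF ultrafilters_not_bot[OF q]] by simp
qed

lemma plim_min_idealD:
  fixes \<phi> :: "'e \<Rightarrow> complex"
  assumes "p \<in> ultrafilters" and "plim p \<in> min_ideal" and "Q \<zeta> = 0" and "bounded_clinear \<phi>" and "\<epsilon> > 0"
  shows "\<not> (\<forall>\<^sub>F s in p. \<epsilon> \<le> cmod (\<phi> (\<pi> s \<zeta>)))"
proof -
  have "plim p \<zeta> = plim p (Q \<zeta>)"
    using assms(2) by (auto simp: min_ideal_eq fun_eq_iff)
  then have "plim p \<zeta> = 0"
    using assms(1,3) by (simp add: linear_0 enveloping_linear plim_enveloping)
  then have "((\<lambda>s. \<phi> (\<pi> s \<zeta>)) \<longlongrightarrow> 0) p"
    using plim_functional[OF assms(1,4), of \<zeta>] assms(4)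
    by (simp add: bounded_clinear_def linear_0 bounded_linear.linear)
  from tendstoD[OF this assms(5)] have "\<forall>\<^sub>F s in p. \<not> \<epsilon> \<le> cmod (\<phi> (\<pi> s \<zeta>))"
    by (simp add: not_le)
  then show ?thesis
    by (simp add: not_eventually_ultrafilter[OF assms(1)])
qed

text \<open>An operator of the hull that kills the kernel of \<open>Q\<close> is unchanged by
  composing with \<open>Q\<close> first, since \<open>Q \<xi> - \<xi>\<close> lies in that kernel.
  The hypothesis is phrased through sets not belonging to \<open>p\<close>, so that ideals and means
  can test it.\<close>

lemma plim_min_idealI:
  assumes p: "p \<in> ultrafilters"
    and "\<And>\<zeta> (\<phi> :: 'e \<Rightarrow> complex) \<epsilon>. Q \<zeta> = 0 \<Longrightarrow> bounded_clinear \<phi> \<Longrightarrow> \<epsilon> > 0 \<Longrightarrow> \<not> (\<forall>\<^sub>F s in p. \<epsilon> \<le> cmod (\<phi> (\<pi> s \<zeta>)))"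
  shows "plim p \<in> min_ideal"
proof -
  have zero: "plim p \<zeta> = 0" if \<zeta>: "Q \<zeta> = 0" for \<zeta>
  proof (rule eq_if_functionals_eq)
    fix \<phi> :: "'e \<Rightarrow> complex" assume \<phi>: "bounded_clinear \<phi>"
    have "((\<lambda>s. \<phi> (\<pi> s \<zeta>)) \<longlongrightarrow> 0) p"
    proof (rule tendstoI)
      fix \<epsilon> :: real assume "\<epsilon> > 0"
      from assms(2)[OF \<zeta> \<phi> this] show "\<forall>\<^sub>F s in p. dist (\<phi> (\<pi> s \<zeta>)) 0 < \<epsilon>"
        by (simp add: not_eventually_ultrafilter[OF p] not_le)
    qed
    then have "\<phi> (plim p \<zeta>) = 0"
      using tendsto_unique[OF ultrafilters_not_bot[OF p] plim_functional[OF p \<phi>]] by simp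
    then show "\<phi> (plim p \<zeta>) = \<phi> 0"
      using \<phi> by (simp add: bounded_clinear_def linear_0 bounded_linear.linear)
  qed
  have "plim p (Q \<xi>) = plim p \<xi>" for \<xi>
  proof -
    have "Q (Q \<xi> - \<xi>) = 0"
      using fun_cong[OF Q_idem, of \<xi>] by (simp add: linear_diff enveloping_linear Q_enveloping)
    then show ?thesis
      using zero[of "Q \<xi> - \<xi>"] by (simp add: linear_diff enveloping_linear plim_enveloping p)
  qed
  then show ?thesis
    using plim_enveloping[OF p] by (auto simp: min_ideal_eq)
qed

lemma plim_preimage_ideal: "two_sided_ideal ultrafilters (uf_mult (*)) {p \<in> ultrafilters. plim p \<in> min_ideal}"
  unfolding two_sided_ideal_def
proof (intro conjI ballI)
  show "{p \<in> ultrafilters. plim p \<in> min_ideal} \<noteq> {}"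
    using ex_plim_eq[OF Q_enveloping] Q_min_ideal by auto
qed (auto simp: plim_uf_mult uf_mult_ultrafilters min_ideal_comp plim_enveloping)

text \<open>A set belonging to \<open>p\<close> belongs to some \<open>k\<close> in
  \<open>K_beta\<close>, and \<open>K_beta\<close> lies in the preimage of \<open>min_ideal\<close>,
  which excludes the sets of large values.\<close>

lemma plim_closure_K_beta:
  assumes "p \<in> uf_topology closure_of K_beta"
  shows "plim p \<in> min_ideal"
proof (rule plim_min_idealI)
  show "p \<in> ultrafilters"
    using assms uf_closure_of_subset_ultrafilters by blast
  fix \<zeta> and \<phi> :: "'e \<Rightarrow> complex" and \<epsilon> :: real
  assume *: "Q \<zeta> = 0" "bounded_clinear \<phi>" "\<epsilon> > 0"
  show "\<not> (\<forall>\<^sub>F s in p. \<epsilon> \<le> cmod (\<phi> (\<pi> s \<zeta>)))"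
  proof
    assume "\<forall>\<^sub>F s in p. \<epsilon> \<le> cmod (\<phi> (\<pi> s \<zeta>))"
    then obtain k where k: "k \<in> K_beta" "\<forall>\<^sub>F s in k. \<epsilon> \<le> cmod (\<phi> (\<pi> s \<zeta>))"
      using in_uf_closure_ofD[OF assms] by blast
    have "k \<in> ultrafilters" "plim k \<in> min_ideal"
      using k(1) plim_preimage_ideal unfolding K_beta_def smallest_ideal_def by blast+
    from plim_min_idealD[OF this *] k(2) show False by blast
  qed
qed

lemma limitin_projection_if_idempotent:
  assumes "p \<in> ultrafilters" and "plim p \<in> min_ideal" and "uf_mult (*) p p = p"
  shows "limitin weak_operator_topology \<pi> (JdLG_projection \<pi>) p"
  using Q_unique[OF assms(2)] plim_uf_mult[OF assms(1,1)] limitin_plim[OF assms(1)] assms(3)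
  by (simp add: JdLG_projection_eq)

end

section \<open>Invariant means and the almost weakly stable part\<close>

text \<open>The sets \<open>D n\<close> below exhaust the union of \<open>A n, A (Suc n), \<dots>\<close> up to \<open>\<delta> / 2 ^ (n + 2)\<close>. Hence they
  have the finite intersection property, and an ultrafilter containing all of them contains infinitely
  many \<open>A n\<close>.\<close>

lemma infinite_subfamily_fip:
  fixes \<mu> :: "'a set \<Rightarrow> real" and A :: "nat \<Rightarrow> 'a set"
  assumes nonneg: "\<And>B. 0 \<le> \<mu> B"
    and additive: "\<And>B C. B \<inter> C = {} \<Longrightarrow> \<mu> (B \<union> C) = \<mu> B + \<mu> C"
    and \<delta>: "0 < \<delta>" "\<And>n. \<delta> \<le> \<mu> (A n)"
  shows "\<exists>I. infinite I \<and> (\<forall>F. finite F \<longrightarrow> F \<subseteq> I \<longrightarrow> (\<Inter>i\<in>F. A i) \<noteq> {})"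
proof -
  have mono: "\<mu> B \<le> \<mu> C" if "B \<subseteq> C" for B C
  proof -
    have "\<mu> C = \<mu> B + \<mu> (C - B)"
      using additive[of B "C - B"] that by (simp add: Un_absorb1)
    then show ?thesis using nonneg[of "C - B"] by simp
  qed
  have empty: "\<mu> {} = 0" using additive[of "{}" "{}"] by simp
  have subadd: "\<mu> (B \<union> C) \<le> \<mu> B + \<mu> C" for B C
    using additive[of B "C - B"] mono[of "C - B" C] by auto
  \<comment> \<open>As \<open>\<mu>\<close> is only finitely additive, unions stop at
    \<open>N\<close>, and \<open>s n\<close> plays the part of the measure of the whole
    tail.\<close>
  define U where "U = (\<lambda>n N. \<Union>i\<in>{n..<N}. A i)"
  define s where "s = (\<lambda>n. SUP N. \<mu> (U n N))"
  have U_le: "\<mu> (U n N) \<le> s n" for n N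
    unfolding s_def by (intro cSUP_upper bdd_aboveI[of _ "\<mu> UNIV"]) (auto intro: mono)
  have s_ge: "\<delta> \<le> s n" for n
    using \<delta>(2)[of n] mono[of "A n" "U n (Suc n)"] U_le[of n "Suc n"] by (simp add: U_def)
  have "\<exists>N. s n - \<delta> / 2 ^ (n + 2) < \<mu> (U n N)" for n
  proof -
    have "s n - \<delta> / 2 ^ (n + 2) < (SUP N. \<mu> (U n N))"
      using \<delta>(1) by (simp add: s_def)
    then obtain x where "x \<in> range (\<lambda>N. \<mu> (U n N))" "s n - \<delta> / 2 ^ (n + 2) < x"
      by (rule less_cSupE) auto
    then show ?thesis by auto
  qed
  then obtain N where N: "\<And>n. s n - \<delta> / 2 ^ (n + 2) < \<mu> (U n (N n))"
    by metis
  define D where "D = (\<lambda>n. U n (N n))"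
  have diff: "\<mu> (D k - D n) \<le> \<delta> / 2 ^ (n + 2)" if "n \<le> k" for n k
  proof -
    have "D n \<union> D k \<subseteq> U n (max (N n) (N k))"
      using that by (fastforce simp: D_def U_def)
    then have "\<mu> (D n \<union> (D k - D n)) \<le> s n"
      using mono[of "D n \<union> D k" "U n (max (N n) (N k))"] U_le[of n "max (N n) (N k)"] by simp
    then show ?thesis
      using additive[of "D n" "D k - D n"] N[of n] by (auto simp: D_def)
  qed
  \<comment> \<open>This bounds the total loss in passing from \<open>D k\<close> to its
    intersection with the earlier \<open>D n\<close>.\<close>
  have union: "\<mu> (\<Union>n<m. D k - D n) \<le> (\<Sum>n<m. \<delta> / 2 ^ (n + 2))" if "m \<le> k" for k m
    using that
  proof (induction m)
    case (Suc m)
    have "\<mu> (\<Union>n<Suc m. D k - D n) \<le> \<mu> (\<Union>n<m. D k - D n) + \<mu> (D k - D m)"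
      using subadd[of "D k - D m" "\<Union>n<m. D k - D n"] by (simp add: lessThan_Suc add.commute)
    then show ?case using Suc diff[of m k] by simp
  qed (simp add: empty)
  have sum: "(\<Sum>n<m. \<delta> / 2 ^ (n + 2)) = \<delta> / 2 - \<delta> / 2 ^ (m + 1)" for m
    by (induction m) (simp_all add: field_simps)
  have ne: "(\<Inter>n\<in>{..k}. D n) \<noteq> {}" for k
  proof
    assume "(\<Inter>n\<in>{..k}. D n) = {}"
    then have "D k \<subseteq> (\<Union>n<k. D k - D n)"
      by (force simp: le_less)
    then have "\<mu> (D k) \<le> \<delta> / 2 - \<delta> / 2 ^ (k + 1)"
      using mono[of "D k" "\<Union>n<k. D k - D n"] union[of k k] sum[of k] by simp
    moreover have "\<delta> / 2 ^ (k + 2) \<le> \<delta> / 2"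
      using \<delta>(1) by (intro divide_left_mono) (simp_all add: power_increasing[of 1 "k + 2" "2::real", simplified])
    moreover have "\<delta> / 2 ^ (k + 1) > 0" using \<delta>(1) by simp
    \<comment> \<open>The measure of \<open>D k\<close> exceeds
      \<open>\<delta> - \<delta> / 2 ^ (k + 2)\<close>, hence \<open>\<delta> / 2\<close>, which is
      more than the total loss.\<close>
    ultimately show False
      using N[of k] s_ge[of k] \<delta>(1) unfolding D_def by linarith
  qed
  have "\<exists>p\<in>ultrafilters. \<forall>B\<in>range D. \<forall>\<^sub>F x in p. x \<in> B"
  proof (rule ex_ultrafilter_fip)
    fix \<F> assume "finite \<F>" "\<F> \<subseteq> range D"
    then obtain M where M: "finite M" "\<F> = D ` M" by (meson finite_subset_image)
    obtain k where "M \<subseteq> {..k}"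
      using M(1) by (auto simp: finite_nat_iff_bounded_le)
    then have "(\<Inter>n\<in>{..k}. D n) \<subseteq> \<Inter>\<F>" unfolding M(2) by blast
    then show "\<Inter>\<F> \<noteq> {}" using ne[of k] by blast
  qed
  then obtain p where p: "p \<in> ultrafilters" "\<And>n. \<forall>\<^sub>F x in p. x \<in> D n" by blast
  define I where "I = {i. \<forall>\<^sub>F x in p. x \<in> A i}"
  \<comment> \<open>\<open>D (Suc n)\<close> is a finite union of sets \<open>A i\<close> with
    \<open>i > n\<close>, and the ultrafilter selects one of them.\<close>
  have "\<exists>i>n. i \<in> I" for n
  proof -
    have "\<forall>\<^sub>F x in p. \<exists>i\<in>{Suc n..<N (Suc n)}. x \<in> A i"
      using p(2)[of "Suc n"] by (simp add: D_def U_def)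
    then have "\<exists>i\<in>{Suc n..<N (Suc n)}. \<forall>\<^sub>F x in p. x \<in> A i"
      by (simp add: eventually_bex_ultrafilter[OF p(1)])
    then show ?thesis by (auto simp: I_def Suc_le_eq)
  qed
  then have "infinite I" by (simp add: infinite_nat_iff_unbounded)
  moreover have "(\<Inter>i\<in>F. A i) \<noteq> {}" if F: "finite F" "F \<subseteq> I" for F
  proof -
    have "\<forall>\<^sub>F x in p. \<forall>i\<in>F. x \<in> A i"
      using F by (intro eventually_ball_finite) (auto simp: I_def)
    then obtain x where "\<forall>i\<in>F. x \<in> A i"
      using eventually_happens'[OF ultrafilters_not_bot[OF p(1)]] by blast
    then show ?thesis by blast
  qed
  ultimately show ?thesis by blast
qed

lemma bounded_range_indicator: "bounded (range (indicator A :: 'a \<Rightarrow> complex))"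
  by (rule finite_imp_bounded) (rule finite_subset[of _ "{0, 1}"], auto simp: indicator_def)

lemma
  assumes m: "is_mean m"
  shows mean_indicator_nonneg: "0 \<le> Re (m (indicator B))"
    and mean_indicator_Un: "B \<inter> C = {} \<Longrightarrow>
      Re (m (indicator (B \<union> C))) = Re (m (indicator B)) + Re (m (indicator C))"
proof -
  have "m (indicator B) \<in> \<real>\<^sub>\<ge>\<^sub>0"
    using m bounded_range_indicator[of B] unfolding is_mean_def
    by (metis complex_nonneg_Reals_iff indicator_simps one_complex.sel zero_complex.sel zero_le_one order_refl)
  then show "0 \<le> Re (m (indicator B))"
    by (simp add: complex_nonneg_Reals_iff)
  assume "B \<inter> C = {}"
  then have "(indicator (B \<union> C) :: _ \<Rightarrow> complex) = (\<lambda>s. indicator B s + indicator C s)"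
    by (auto simp: indicator_def fun_eq_iff)
  then show "Re (m (indicator (B \<union> C))) = Re (m (indicator B)) + Re (m (indicator C))"
    using m bounded_range_indicator[of B] bounded_range_indicator[of C] by (simp add: is_mean_def)
qed

lemma left_invariant_mean_vimage:
  assumes "left_invariant_mean m"
  shows "m (indicator {t. s * t \<in> A}) = m (indicator A)"
proof -
  have "(indicator {t. s * t \<in> A} :: _ \<Rightarrow> complex) = (\<lambda>t. indicator A (s * t))"
    by (auto simp: indicator_def fun_eq_iff)
  then show ?thesis
    using assms bounded_range_indicator[of A] by (simp add: left_invariant_mean_def)
qed

text \<open>Bi-amenability makes the set of left-invariant means nonempty, so that a supremum of
  values that are all at most 0 is itself at most 0.\<close>

lemma D_star_ex_mean:
  assumes "bi_amenable TYPE('s::semigroup_mult)" and "p \<in> (D_star :: 's filter set)"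
    and "\<forall>\<^sub>F s in p. s \<in> A"
  shows "\<exists>m. left_invariant_mean m \<and> 0 < Re (m (indicator A))"
proof (rule ccontr)
  assume "\<not> ?thesis"
  then have "x \<le> 0" if "x \<in> {Re (m (indicator A)) | m. left_invariant_mean m}" for x
    using that by force
  moreover have "{Re (m (indicator A)) | m. left_invariant_mean m} \<noteq> {}"
    using assms(1) unfolding bi_amenable_def bi_invariant_mean_def by blast
  ultimately have "upper_density A \<le> 0"
    unfolding upper_density_def by (intro cSup_least)
  then show False using assms(2,3) unfolding D_star_def by force
qed

text \<open>Dependent choice on pairs, starting from the empty set; \<open>G n\<close> is carried
  along to collect the earlier terms, so that \<open>u n\<close> is chosen against all of
  them.\<close>

lemma ex_diagonal_sequence:
  assumes "\<And>G. finite G \<Longrightarrow> \<exists>v. P G v"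
  shows "\<exists>(u :: nat \<Rightarrow> 'a) G. (\<forall>n. finite (G n) \<and> u ` {..<n} \<subseteq> G n \<and> P (G n) (u n))"
proof -
  have "\<exists>s. \<forall>n::nat. (finite (fst (s n)) \<and> P (fst (s n)) (snd (s n))) \<and>
      fst (s (Suc n)) = insert (snd (s n)) (fst (s n))"
  proof (rule dependent_nat_choice[of "\<lambda>_ x. finite (fst x) \<and> P (fst x) (snd x)"
        "\<lambda>_ x y. fst y = insert (snd x) (fst x)"])
    show "\<exists>x. finite (fst x) \<and> P (fst x) (snd x)"
      using assms[of "{}"] by auto
  next
    fix x :: "'a set \<times> 'a" and n :: nat
    assume "finite (fst x) \<and> P (fst x) (snd x)"
    then show "\<exists>y. (finite (fst y) \<and> P (fst y) (snd y)) \<and> fst y = insert (snd x) (fst x)"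
      using assms[of "insert (snd x) (fst x)"] by auto
  qed
  then obtain s where s: "\<And>n. finite (fst (s n))" "\<And>n. P (fst (s n)) (snd (s n))"
    "\<And>n. fst (s (Suc n)) = insert (snd (s n)) (fst (s n))"
    by blast
  have "(\<lambda>n. snd (s n)) ` {..<n} \<subseteq> fst (s n)" for n
    by (induction n) (auto simp: s(3) lessThan_Suc)
  then show ?thesis
    using s by (intro exI[of _ "\<lambda>n. snd (s n)"] exI[of _ "\<lambda>n. fst (s n)"]) auto
qed

context JdLG_representation
begin

text \<open>Otherwise one finds \<open>u n\<close> and \<open>t n\<close> such that \<open>\<phi> (\<pi> (u i * t k) \<zeta>)\<close> stays away from \<open>0\<close> for \<open>i \<le> k\<close>, because the
  translates of \<open>A\<close> by the \<open>u i\<close> intersect, and is small for \<open>i > k\<close>, because \<open>\<pi> (u i)\<close> is close to \<open>Q\<close>.\<close>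

lemma left_invariant_mean_null:
  fixes \<phi> :: "'e \<Rightarrow> complex"
  assumes m: "left_invariant_mean m" and \<zeta>: "Q \<zeta> = 0" and \<phi>: "bounded_clinear \<phi>" and \<epsilon>: "\<epsilon> > 0"
  shows "Re (m (indicator {s. \<epsilon> \<le> cmod (\<phi> (\<pi> s \<zeta>))})) \<le> 0"
proof (rule ccontr)
  define A where "A = {s. \<epsilon> \<le> cmod (\<phi> (\<pi> s \<zeta>))}"
  assume "\<not> ?thesis"
  then have \<delta>: "0 < Re (m (indicator A))" by (simp add: A_def)
  have mean: "is_mean m" using m by (simp add: left_invariant_mean_def)
  \<comment> \<open>A common right factor is fixed for every set \<open>G\<close> before
    \<open>u\<close> is constructed; where none exists the value is arbitrary. Since
    \<open>I\<close> is known only afterwards, \<open>near\<close> controls all subsets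
    \<open>H\<close> of \<open>G\<close>.\<close>
  define \<tau> where "\<tau> = (\<lambda>G. SOME t. \<forall>g\<in>G. g * t \<in> A)"
  have near: "\<exists>v. \<forall>H\<in>Pow G. cmod (\<phi> (\<pi> v (\<pi> (\<tau> H) \<zeta>))) < \<epsilon> / 2" if G: "finite G" for G
  proof -
    \<comment> \<open>Along an ultrafilter with limit \<open>Q\<close>, which commutes with
      \<open>\<pi> (\<tau> H)\<close> and therefore kills each of the finitely many vectors
      \<open>\<pi> (\<tau> H) \<zeta>\<close>.\<close>
    obtain p where p: "p \<in> ultrafilters" "plim p = Q"
      using ex_plim_eq[OF Q_enveloping] by blast
    have "\<forall>\<^sub>F v in p. \<forall>H\<in>Pow G. cmod (\<phi> (\<pi> v (\<pi> (\<tau> H) \<zeta>))) < \<epsilon> / 2"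
    proof (rule eventually_ball_finite, use G in simp, rule ballI)
      fix H
      have "Q (\<pi> (\<tau> H) \<zeta>) = \<pi> (\<tau> H) (Q \<zeta>)"
        using fun_cong[OF Q_central[OF \<pi>_enveloping[of "\<tau> H"]], of \<zeta>] by simp
      then have "\<phi> (Q (\<pi> (\<tau> H) \<zeta>)) = 0"
        using \<zeta> \<phi> by (simp add: linear_0 enveloping_linear \<pi>_enveloping bounded_clinear_def bounded_linear.linear)
      then have "((\<lambda>v. \<phi> (\<pi> v (\<pi> (\<tau> H) \<zeta>))) \<longlongrightarrow> 0) p"
        using plim_functional[OF p(1) \<phi>, of "\<pi> (\<tau> H) \<zeta>"] p(2) by simp
      from tendstoD[OF this, of "\<epsilon> / 2"]
      show "\<forall>\<^sub>F v in p. cmod (\<phi> (\<pi> v (\<pi> (\<tau> H) \<zeta>))) < \<epsilon> / 2"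
        using \<epsilon> by simp
    qed
    then show ?thesis
      using eventually_happens'[OF ultrafilters_not_bot[OF p(1)]] by blast
  qed
  have "\<exists>u G. \<forall>n::nat. finite (G n) \<and> u ` {..<n} \<subseteq> G n \<and>
      (\<forall>H\<in>Pow (G n). cmod (\<phi> (\<pi> (u n) (\<pi> (\<tau> H) \<zeta>))) < \<epsilon> / 2)"
    by (rule ex_diagonal_sequence[where
          P = "\<lambda>G v. \<forall>H\<in>Pow G. cmod (\<phi> (\<pi> v (\<pi> (\<tau> H) \<zeta>))) < \<epsilon> / 2"]) (rule near)
  then obtain u G where uG: "\<forall>n::nat. finite (G n) \<and> u ` {..<n} \<subseteq> G n \<and>
      (\<forall>H\<in>Pow (G n). cmod (\<phi> (\<pi> (u n) (\<pi> (\<tau> H) \<zeta>))) < \<epsilon> / 2)"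
    by (elim exE)
  \<comment> \<open>By left invariance all the sets \<open>{t. u i * t \<in> A}\<close> have the
    same mean as \<open>A\<close>.\<close>
  have "\<exists>I. infinite I \<and> (\<forall>F. finite F \<longrightarrow> F \<subseteq> I \<longrightarrow> (\<Inter>i\<in>F. {t. u i * t \<in> A}) \<noteq> {})"
    by (rule infinite_subfamily_fip[where \<mu> = "\<lambda>B. Re (m (indicator B))" and \<delta> = "Re (m (indicator A))"])
      (simp_all add: mean_indicator_nonneg[OF mean] mean_indicator_Un[OF mean] \<delta>
        left_invariant_mean_vimage[OF m])
  then obtain I where I: "infinite I"
    and fip: "\<And>F. finite F \<Longrightarrow> F \<subseteq> I \<Longrightarrow> (\<Inter>i\<in>F. {t. u i * t \<in> A}) \<noteq> {}"
    by blast
  define t where "t = (\<lambda>k. \<tau> (u ` (I \<inter> {..k})))"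
  have large: "u i * t k \<in> A" if "i \<in> I" "i \<le> k" for i k
  proof -
    have "\<exists>t. \<forall>g\<in>u ` (I \<inter> {..k}). g * t \<in> A"
      using fip[of "I \<inter> {..k}"] by auto
    from someI_ex[OF this] show ?thesis
      unfolding t_def \<tau>_def using that by blast
  qed
  have small: "cmod (\<phi> (\<pi> (u i) (\<pi> (t k) \<zeta>))) < \<epsilon> / 2" if "k < i" for i k
  proof -
    have "u ` (I \<inter> {..k}) \<subseteq> G i"
      using spec[OF uG, of i] that by (auto simp: image_subset_iff)
    then show ?thesis
      unfolding t_def using spec[OF uG, of i] by (simp only: Pow_iff)
  qed
  \<comment> \<open>These closed sets are disjoint, so the double limit property is violated. The
    index \<open>i\<close> runs through \<open>I\<close>, where the lower bound was
    obtained.\<close>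
  have "{z. \<epsilon> \<le> cmod z} \<inter> {z. cmod z \<le> \<epsilon> / 2} \<noteq> {}"
  proof (rule wot.double_limit[OF compact_enveloping continuous_map_weak_operator_functional[OF \<phi>, of \<zeta>],
        where x = "\<lambda>i. \<pi> (u i)" and y = "\<lambda>k. \<pi> (t k)" and F = "inf sequentially (principal I)"
          and G = sequentially])
    show "inf sequentially (principal I) \<noteq> bot"
      using I by (simp add: trivial_limit_def eventually_inf_principal eventually_sequentially
          infinite_nat_iff_unbounded_le)
    show "closed {z. \<epsilon> \<le> cmod z}" "closed {z. cmod z \<le> \<epsilon> / 2}"
      by (auto intro!: closed_Collect_le continuous_intros)
    show "\<forall>\<^sub>F i in inf sequentially (principal I). \<forall>\<^sub>F k in sequentially.
        \<phi> ((\<pi> (u i) \<circ> \<pi> (t k)) \<zeta>) \<in> {z. \<epsilon> \<le> cmod z}"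
      unfolding eventually_inf_principal
    proof (rule always_eventually, intro allI impI)
      fix i assume "i \<in> I"
      show "\<forall>\<^sub>F k in sequentially. \<phi> ((\<pi> (u i) \<circ> \<pi> (t k)) \<zeta>) \<in> {z. \<epsilon> \<le> cmod z}"
        using eventually_ge_at_top[of i]
      proof eventually_elim
        case (elim k)
        then show ?case using large[OF \<open>i \<in> I\<close>] by (simp add: A_def \<pi>_mult)
      qed
    qed
    show "\<forall>\<^sub>F k in sequentially. \<forall>\<^sub>F i in inf sequentially (principal I).
        \<phi> ((\<pi> (u i) \<circ> \<pi> (t k)) \<zeta>) \<in> {z. cmod z \<le> \<epsilon> / 2}"
    proof (rule always_eventually, rule allI)
      fix k
      have "\<forall>\<^sub>F i in sequentially. \<phi> ((\<pi> (u i) \<circ> \<pi> (t k)) \<zeta>) \<in> {z. cmod z \<le> \<epsilon> / 2}"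
        using eventually_gt_at_top[of k]
      proof eventually_elim
        case (elim i)
        then show ?case using small[of k i] by simp
      qed
      then show "\<forall>\<^sub>F i in inf sequentially (principal I).
          \<phi> ((\<pi> (u i) \<circ> \<pi> (t k)) \<zeta>) \<in> {z. cmod z \<le> \<epsilon> / 2}"
        by (rule filter_leD[OF inf_le1])
    qed
  qed (simp_all add: \<pi>_enveloping)
  then show False using \<epsilon> by auto
qed

lemma plim_D_star:
  assumes "bi_amenable TYPE('s)" and "p \<in> D_star"
  shows "plim p \<in> min_ideal"
proof (rule plim_min_idealI)
  show "p \<in> ultrafilters" using assms(2) by (simp add: D_star_def)
  fix \<zeta> and \<phi> :: "'e \<Rightarrow> complex" and \<epsilon> :: real
  assume *: "Q \<zeta> = 0" "bounded_clinear \<phi>" "\<epsilon> > 0"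
  show "\<not> (\<forall>\<^sub>F s in p. \<epsilon> \<le> cmod (\<phi> (\<pi> s \<zeta>)))"
  proof
    assume "\<forall>\<^sub>F s in p. \<epsilon> \<le> cmod (\<phi> (\<pi> s \<zeta>))"
    then have "\<forall>\<^sub>F s in p. s \<in> {s. \<epsilon> \<le> cmod (\<phi> (\<pi> s \<zeta>))}" by simp
    from D_star_ex_mean[OF assms this] left_invariant_mean_null[OF _ *] show False
      by fastforce
  qed
qed

end

section \<open>Ultrafilters of the form \<open>q\<inverse>q\<close>\<close>

lemma uf_mult_assoc:
  fixes x y z :: "'s::semigroup_mult filter"
  shows "uf_mult (*) (uf_mult (*) x y) z = uf_mult (*) x (uf_mult (*) y z)"
  by (simp add: filter_eq_iff eventually_uf_mult mult.assoc)

lemma left_reversible_common_multiple: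
  assumes "left_reversible TYPE('s::semigroup_mult)" and "finite F"
  shows "\<exists>z::'s. \<forall>s\<in>F. z \<in> range ((*) s)"
  using assms(2)
proof induction
  case (insert a F)
  then obtain z where z: "\<And>s. s \<in> F \<Longrightarrow> z \<in> range ((*) s)" by blast
  have "range ((*) z) \<inter> range ((*) a) \<noteq> {}"
    using assms(1) unfolding left_reversible_def by blast
  then obtain b c where bc: "z * b = a * c" by auto
  have "z * b \<in> range ((*) s)" if "s \<in> F" for s
    using z[OF that] by (auto simp: mult.assoc)
  moreover have "z * b \<in> range ((*) a)" using bc by simp
  ultimately show ?case by blast
qed simp

text \<open>Common multiples of finitely many elements give nonemptiness. For products with
  \<open>a\<close> on the left, a relation \<open>c * b = s * d\<close> shows that translation by
  \<open>c\<close> carries b S, a member of \<open>x\<close>, into s S.\<close>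

lemma left_reversible_ideal:
  assumes lr: "left_reversible TYPE('s::semigroup_mult)"
  shows "two_sided_ideal ultrafilters (uf_mult (*))
    {x \<in> ultrafilters. \<forall>s::'s. \<forall>\<^sub>F t in x. t \<in> range ((*) s)}"
  unfolding two_sided_ideal_def
proof (intro conjI ballI)
  have "\<exists>p\<in>ultrafilters. \<forall>A\<in>range (\<lambda>s::'s. range ((*) s)). \<forall>\<^sub>F t in p. t \<in> A"
  proof (rule ex_ultrafilter_fip)
    fix \<F> assume "finite \<F>" "\<F> \<subseteq> range (\<lambda>s::'s. range ((*) s))"
    then obtain F where F: "finite F" "\<F> = (\<lambda>s::'s. range ((*) s)) ` F" by (meson finite_subset_image)
    then show "\<Inter>\<F> \<noteq> {}"
      using left_reversible_common_multiple[OF lr F(1)] by blast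
  qed
  then show "{x \<in> ultrafilters. \<forall>s::'s. \<forall>\<^sub>F t in x. t \<in> range ((*) s)} \<noteq> {}" by blast
next
  fix a x :: "'s filter"
  assume a: "a \<in> ultrafilters" and "x \<in> {x \<in> ultrafilters. \<forall>s. \<forall>\<^sub>F t in x. t \<in> range ((*) s)}"
  then have x: "x \<in> ultrafilters" and xs: "\<And>s. \<forall>\<^sub>F t in x. t \<in> range ((*) s)"
    by auto
  have "\<forall>\<^sub>F t in x. c * t \<in> range ((*) s)" for c s
  proof -
    have "range ((*) c) \<inter> range ((*) s) \<noteq> {}"
      using lr unfolding left_reversible_def by blast
    then obtain b d where bd: "c * b = s * d" by auto
    show ?thesis
      using xs[of b]
    proof eventually_elim
      case (elim t)
      then obtain e where "t = b * e" by auto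
      then have "c * t = s * (d * e)" using bd by (metis mult.assoc)
      then show ?case by simp
    qed
  qed
  then show "uf_mult (*) a x \<in> {x \<in> ultrafilters. \<forall>s. \<forall>\<^sub>F t in x. t \<in> range ((*) s)}"
    using uf_mult_ultrafilters[OF x a] by (simp add: eventually_uf_mult)
  have "\<forall>\<^sub>F c in x. \<forall>\<^sub>F t in a. c * t \<in> range ((*) s)" for s
    using xs[of s] by eventually_elim (auto simp: mult.assoc)
  then show "uf_mult (*) x a \<in> {x \<in> ultrafilters. \<forall>s. \<forall>\<^sub>F t in x. t \<in> range ((*) s)}"
    using uf_mult_ultrafilters[OF a x] by (simp add: eventually_uf_mult)
qed blast

lemma cancellative_inj: "cancellative TYPE('s::semigroup_mult) \<Longrightarrow> inj ((*) (s::'s))"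
  unfolding cancellative_def by (blast intro: injI)

lemma eventually_filtercomap_inj:
  assumes "inj f" and "\<forall>\<^sub>F t in q. t \<in> f ` Collect P"
  shows "\<forall>\<^sub>F r in filtercomap f q. P r"
  unfolding eventually_filtercomap
  by (rule exI[of _ "\<lambda>t. t \<in> f ` Collect P"]) (use assms in \<open>auto dest: injD\<close>)

text \<open>Membership in q^{-1} q is unfolded inside the semigroup: for q-most \<open>s\<close> and
  then q-most \<open>t\<close>, the quotient s^{-1} t is an element satisfying \<open>P\<close>. For
  trivial \<open>P\<close> this says that s S belongs to \<open>q\<close>.\<close>

lemma eventually_inverse_product:
  assumes G: "group_of_right_quotients \<iota> gm ge gi" and pq: "is_inverse_product \<iota> gm gi p q"
    and P: "\<forall>\<^sub>F r in p. P r"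
  shows "\<forall>\<^sub>F s in q. \<forall>\<^sub>F t in q. t \<in> (*) s ` Collect P"
proof -
  interpret group gm ge gi
    using G by (simp add: group_of_right_quotients_def)
  have inj: "inj \<iota>" and hom: "\<And>s t. \<iota> (s * t) = gm (\<iota> s) (\<iota> t)"
    using G by (auto simp: group_of_right_quotients_def)
  have "\<forall>\<^sub>F g in filtermap \<iota> p. \<exists>r. g = \<iota> r \<and> P r"
    using P by (auto simp: eventually_filtermap elim: eventually_mono)
  then have "\<forall>\<^sub>F s in q. \<forall>\<^sub>F t in q. \<exists>r. gm (gi (\<iota> s)) (\<iota> t) = \<iota> r \<and> P r"
    unfolding pq[unfolded is_inverse_product_def] eventually_uf_mult eventually_filtermap .
  moreover have "t \<in> (*) s ` Collect P" if "\<exists>r. gm (gi (\<iota> s)) (\<iota> t) = \<iota> r \<and> P r" for s t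
  proof -
    from that obtain r where r: "gm (gi (\<iota> s)) (\<iota> t) = \<iota> r" "P r" by blast
    have "\<iota> t = gm (gm (\<iota> s) (gi (\<iota> s))) (\<iota> t)" by simp
    also have "\<dots> = \<iota> (s * r)" by (simp only: assoc r(1) hom)
    finally have "t = s * r" using inj by (auto dest: injD)
    then show ?thesis using r(2) by blast
  qed
  ultimately show ?thesis
    by (auto elim!: eventually_mono)
qed

context JdLG_representation
begin

text \<open>By left reversibility the ultrafilters \<open>x\<close> containing every \<open>s S\<close> form an ideal \<open>R\<close>, and
  \<open>K(\<beta>S) \<subseteq> R J\<close> with \<open>J\<close> the preimage of the smallest ideal. For \<open>k = x y\<close> in \<open>R J\<close> one may therefore
  cancel \<open>s\<close> already in \<open>x\<close>.\<close>

lemma K_beta_translate: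
  fixes \<phi> :: "'e \<Rightarrow> complex"
  assumes lr: "left_reversible TYPE('s)" and canc: "cancellative TYPE('s)" and k: "k \<in> K_beta"
    and \<zeta>: "Q \<zeta> = 0" and \<phi>: "bounded_clinear \<phi>" and \<epsilon>: "\<epsilon> > 0"
  shows "\<not> (\<forall>\<^sub>F t in k. t \<in> (*) s ` {r. \<epsilon> \<le> cmod (\<phi> (\<pi> r \<zeta>))})"
proof
  assume ev: "\<forall>\<^sub>F t in k. t \<in> (*) s ` {r. \<epsilon> \<le> cmod (\<phi> (\<pi> r \<zeta>))}"
  define R where "R = {x \<in> ultrafilters. \<forall>s::'s. \<forall>\<^sub>F t in x. t \<in> range ((*) s)}"
  define J where "J = {p \<in> ultrafilters. plim p \<in> min_ideal}"
  have R: "two_sided_ideal ultrafilters (uf_mult (*)) R"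
    unfolding R_def by (rule left_reversible_ideal[OF lr])
  have J: "two_sided_ideal ultrafilters (uf_mult (*)) J"
    unfolding J_def by (rule plim_preimage_ideal)
  define I where "I = (\<lambda>(x, y). uf_mult (*) x y) ` (R \<times> J)"
  \<comment> \<open>Left factors are absorbed by \<open>R\<close> and right factors by
    \<open>J\<close>, so the products form an ideal, which must contain
    \<open>K_beta\<close>.\<close>
  have "two_sided_ideal ultrafilters (uf_mult (*)) I"
    unfolding two_sided_ideal_def
  proof (intro conjI ballI)
    show "I \<noteq> {}" "I \<subseteq> ultrafilters"
      using R J by (auto simp: I_def two_sided_ideal_def intro!: uf_mult_ultrafilters)
    fix a z :: "'s filter" assume a: "a \<in> ultrafilters" and "z \<in> I"
    then obtain x y where xy: "x \<in> R" "y \<in> J" "z = uf_mult (*) x y" by (auto simp: I_def)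
    have "uf_mult (*) a x \<in> R" "uf_mult (*) y a \<in> J"
      using R J a xy by (auto simp: two_sided_ideal_def)
    then show "uf_mult (*) a z \<in> I" "uf_mult (*) z a \<in> I"
      unfolding I_def xy(3) using xy(1,2)
      by (auto simp: uf_mult_assoc[symmetric] intro: image_eqI[of _ _ "(uf_mult (*) a x, y)"])
        (auto simp: uf_mult_assoc intro: image_eqI[of _ _ "(x, uf_mult (*) y a)"])
  qed
  then have "k \<in> I" using k unfolding K_beta_def smallest_ideal_def by blast
  then obtain x y where x: "x \<in> R" and y: "y \<in> J" and kxy: "k = uf_mult (*) x y"
    by (auto simp: I_def)
  have "\<forall>\<^sub>F a in x. \<forall>\<^sub>F b in y. a * b \<in> (*) s ` {r. \<epsilon> \<le> cmod (\<phi> (\<pi> r \<zeta>))}"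
    using ev by (simp add: kxy eventually_uf_mult)
  moreover have "\<forall>\<^sub>F a in x. a \<in> range ((*) s)" "x \<in> ultrafilters"
    using x by (auto simp: R_def)
  ultimately obtain a where a: "a \<in> range ((*) s)"
    "\<forall>\<^sub>F b in y. a * b \<in> (*) s ` {r. \<epsilon> \<le> cmod (\<phi> (\<pi> r \<zeta>))}"
    using eventually_happens'[OF ultrafilters_not_bot eventually_conj] by blast
  \<comment> \<open>Cancelling \<open>s\<close> in \<open>s * (c * b) = s * r\<close> turns the
    assumption on \<open>k\<close> into one on \<open>y\<close> and the functional
    \<open>\<phi> \<circ> \<pi> c\<close>, contradicting
    \<open>plim y \<in> min_ideal\<close>.\<close>
  obtain c where c: "a = s * c" using a(1) by blast
  have "\<forall>\<^sub>F b in y. \<epsilon> \<le> cmod ((\<phi> \<circ> \<pi> c) (\<pi> b \<zeta>))"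
    using a(2)
  proof eventually_elim
    case (elim b)
    then obtain r where r: "s * (c * b) = s * r" "\<epsilon> \<le> cmod (\<phi> (\<pi> r \<zeta>))"
      by (auto simp: c mult.assoc)
    have "c * b = r"
      by (rule injD[OF cancellative_inj[OF canc] r(1)])
    then show ?case
      using r(2) by (auto simp: \<pi>_mult)
  qed
  then show False
    using plim_min_idealD[OF _ _ \<zeta> functional_enveloping[OF \<phi> \<pi>_enveloping] \<epsilon>, of y c] y
    by (auto simp: J_def)
qed

text \<open>As \<open>plim p\<close> lies in the smallest ideal, it is unchanged by applying
  \<open>Q\<close> afterwards; the limit can thus be computed in the compact group
  \<open>min_ideal\<close>.\<close>

lemma plim_inverse_product:
  assumes canc: "cancellative TYPE('s)" and G: "group_of_right_quotients \<iota> gm ge gi"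
    and pq: "is_inverse_product \<iota> gm gi p q" and p: "p \<in> ultrafilters" and q: "q \<in> ultrafilters"
    and kp: "plim p \<in> min_ideal" and kq: "plim q \<in> min_ideal"
  shows "plim p = Q"
proof (rule ext, rule eq_if_functionals_eq)
  fix \<xi> and \<phi> :: "'e \<Rightarrow> complex" assume \<phi>: "bounded_clinear \<phi>"
  define i where "i = (\<lambda>k. SOME l. l \<in> min_ideal \<and> l \<circ> k = Q \<and> k \<circ> l = Q)"
  have i: "i k \<in> min_ideal" "i k \<circ> k = Q" "k \<circ> i k = Q" if "k \<in> min_ideal" for k
    using someI_ex[of "\<lambda>l. l \<in> min_ideal \<and> l \<circ> k = Q \<and> k \<circ> l = Q"]
      wot.ex_inverse[OF enveloping_facts that] unfolding i_def by blast+
  \<comment> \<open>The limit of \<pi> along s^{-1} q, which is an ultrafilter for q-most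
    \<open>s\<close>.\<close>
  define V where "V = (\<lambda>s. plim (filtercomap ((*) s) q))"
  have "\<forall>\<^sub>F r in p. True" by simp
  from eventually_inverse_product[OF G pq this]
  have "\<forall>\<^sub>F s in q. \<forall>\<^sub>F t in q. t \<in> range ((*) s)" by simp
  then have q': "\<forall>\<^sub>F s in q. filtercomap ((*) s) q \<in> ultrafilters \<and>
      filtermap ((*) s) (filtercomap ((*) s) q) = q"
    by eventually_elim (use filtercomap_inj_ultrafilter[OF q cancellative_inj[OF canc]] in blast)
  have Q\<phi>: "bounded_clinear (\<phi> \<circ> Q)" by (rule functional_enveloping[OF \<phi> Q_enveloping])
  have 1: "((\<lambda>s. (\<phi> \<circ> Q) (V s \<xi>)) \<longlongrightarrow> (\<phi> \<circ> Q) (plim p \<xi>)) q"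
  proof (rule tendsto_of_iterated[where G = "\<lambda>s. filtercomap ((*) s) q" and g = "\<lambda>s t. (\<phi> \<circ> Q) (\<pi> t \<xi>)"])
    fix \<epsilon> :: real assume "\<epsilon> > 0"
    from tendstoD[OF plim_functional[OF p Q\<phi>] this]
    have "\<forall>\<^sub>F r in p. dist ((\<phi> \<circ> Q) (\<pi> r \<xi>)) ((\<phi> \<circ> Q) (plim p \<xi>)) < \<epsilon>" .
    from eventually_inverse_product[OF G pq this]
    show "\<forall>\<^sub>F s in q. \<forall>\<^sub>F t in filtercomap ((*) s) q.
        dist ((\<phi> \<circ> Q) (\<pi> t \<xi>)) ((\<phi> \<circ> Q) (plim p \<xi>)) < \<epsilon>"
      by eventually_elim (rule eventually_filtercomap_inj[OF cancellative_inj[OF canc]])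
  next
    show "\<forall>\<^sub>F s in q. filtercomap ((*) s) q \<noteq> bot \<and>
        ((\<lambda>t. (\<phi> \<circ> Q) (\<pi> t \<xi>)) \<longlongrightarrow> (\<phi> \<circ> Q) (V s \<xi>)) (filtercomap ((*) s) q)"
      using q'
    proof eventually_elim
      case (elim s)
      then show ?case
        using ultrafilters_not_bot plim_functional[OF _ Q\<phi>, of "filtercomap ((*) s) q" \<xi>]
        by (auto simp: V_def)
    qed
  qed
  have factor: "\<forall>\<^sub>F s in q. plim q = \<pi> s \<circ> V s"
    using q'
  proof eventually_elim
    case (elim s)
    show ?case
    proof (rule ext, rule eq_if_functionals_eq)
      fix \<eta> and \<psi> :: "'e \<Rightarrow> complex" assume \<psi>: "bounded_clinear \<psi>"
      have "((\<lambda>t. \<psi> (\<pi> t \<eta>)) \<longlongrightarrow> \<psi> (plim q \<eta>)) (filtermap ((*) s) (filtercomap ((*) s) q))"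
        using elim plim_functional[OF q \<psi>] by simp
      then have "((\<lambda>r. \<psi> (\<pi> s (\<pi> r \<eta>))) \<longlongrightarrow> \<psi> (plim q \<eta>)) (filtercomap ((*) s) q)"
        by (simp add: filterlim_filtermap \<pi>_mult)
      moreover have "((\<lambda>r. \<psi> (\<pi> s (\<pi> r \<eta>))) \<longlongrightarrow> \<psi> (\<pi> s (V s \<eta>))) (filtercomap ((*) s) q)"
        unfolding V_def using elim by (intro plim_functional_\<pi> \<psi>) blast
      ultimately show "\<psi> (plim q \<eta>) = \<psi> ((\<pi> s \<circ> V s) \<eta>)"
        using tendsto_unique ultrafilters_not_bot elim by fastforce
    qed
  qed
  have min_ideal_\<pi>: "Q \<circ> \<pi> s \<in> min_ideal" for s
    by (rule min_ideal_comp(2)[OF \<pi>_enveloping Q_min_ideal])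
  have a: "limitin weak_operator_topology (\<lambda>s. Q \<circ> \<pi> s) (Q \<circ> plim q) q"
    using continuous_map_limit[OF wot.continuous_mult_left limitin_plim[OF q], of Q]
      enveloping_bounded[OF Q_enveloping] by (simp add: o_def topspace_weak_operator_topology)
  have "\<forall>\<^sub>F s in q. i (Q \<circ> \<pi> s) \<in> min_ideal"
    using i(1)[OF min_ideal_\<pi>] by simp
  from compactin_ultrafilter_limit[OF wot.compactin_smallest_ideal[OF enveloping_facts] q this]
  obtain b where b: "limitin weak_operator_topology (\<lambda>s. i (Q \<circ> \<pi> s)) b q" by blast
  \<comment> \<open>Continuity of inversion on the compact group; moreover
    \<open>Q \<circ> plim q\<close> is \<open>plim q\<close>.\<close>
  have "b = i (Q \<circ> plim q)"
  proof (rule wot.limit_inverse(2)[where K = min_ideal and e = Q and i = i and F = q and a = "Q \<circ> plim q"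
        and g = "\<lambda>s. Q \<circ> \<pi> s"])
    show "compactin weak_operator_topology min_ideal"
      by (rule wot.compactin_smallest_ideal[OF enveloping_facts])
    show "x \<circ> y \<in> min_ideal" if "x \<in> min_ideal" "y \<in> min_ideal" for x y
      by (rule min_ideal_comp(1)[OF min_ideal_enveloping[OF that(1)] that(2)])
    show "\<forall>\<^sub>F s in q. Q \<circ> \<pi> s \<in> min_ideal"
      by (simp only: min_ideal_\<pi> eventually_True)
  qed (fact Q_min_ideal Q_comp_min_ideal min_ideal_comp_Q i ultrafilters_not_bot[OF q] a b)+
  then have "b \<circ> plim q = Q"
    using i(2)[OF kq] Q_comp_min_ideal[OF kq] by simp
  then have "((\<lambda>s. \<phi> (i (Q \<circ> \<pi> s) (plim q \<xi>))) \<longlongrightarrow> \<phi> (Q \<xi>)) q"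
    using limitin_weak_operator_functional[OF b \<phi>, of "plim q \<xi>"] by (metis comp_apply)
  moreover have "\<forall>\<^sub>F s in q. \<phi> (i (Q \<circ> \<pi> s) (plim q \<xi>)) = (\<phi> \<circ> Q) (V s \<xi>)"
    using factor
  proof eventually_elim
    case (elim s)
    \<comment> \<open>The factorization of \<open>plim q\<close> is multiplied on the left by
      \<open>Q\<close> and then by the inverse of \<open>Q \<circ> \<pi> s\<close>.\<close>
    have "i (Q \<circ> \<pi> s) \<circ> plim q = i (Q \<circ> \<pi> s) \<circ> (Q \<circ> \<pi> s) \<circ> V s"
      using Q_comp_min_ideal[OF kq] elim by (metis comp_assoc)
    then have "i (Q \<circ> \<pi> s) \<circ> plim q = Q \<circ> V s"
      by (simp only: i(2)[OF min_ideal_\<pi>])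
    then show ?case by (metis comp_apply)
  qed
  ultimately have 2: "((\<lambda>s. (\<phi> \<circ> Q) (V s \<xi>)) \<longlongrightarrow> \<phi> (Q \<xi>)) q"
    by (rule Lim_transform_eventually)
  have "\<phi> (Q (plim p \<xi>)) = \<phi> (Q \<xi>)"
    using tendsto_unique[OF ultrafilters_not_bot[OF q] 1 2] by simp
  then show "\<phi> (plim p \<xi>) = \<phi> (Q \<xi>)"
    using Q_comp_min_ideal[OF kp] by (metis comp_apply)
qed

text \<open>If a set A of large values belonged to \<open>p\<close>, then s A would belong to
  \<open>q\<close> for some \<open>s\<close>, hence to some \<open>k\<close> in
  \<open>K_beta\<close>, which \<open>K_beta_translate\<close> excludes.\<close>

lemma plim_inverse_product_closure_K_beta:
  assumes canc: "cancellative TYPE('s)" and lr: "left_reversible TYPE('s)"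
    and G: "group_of_right_quotients \<iota> gm ge gi"
    and pq: "is_inverse_product \<iota> gm gi p q" and p: "p \<in> ultrafilters"
    and q: "q \<in> uf_topology closure_of K_beta"
  shows "plim p = Q"
proof (rule plim_inverse_product[OF canc G pq p])
  show qu: "q \<in> ultrafilters"
    using q uf_closure_of_subset_ultrafilters by blast
  show "plim q \<in> min_ideal"
    by (rule plim_closure_K_beta[OF q])
  show "plim p \<in> min_ideal"
  proof (rule plim_min_idealI[OF p], rule notI)
    fix \<zeta> and \<phi> :: "'e \<Rightarrow> complex" and \<epsilon> :: real
    assume *: "Q \<zeta> = 0" "bounded_clinear \<phi>" "\<epsilon> > 0" and "\<forall>\<^sub>F s in p. \<epsilon> \<le> cmod (\<phi> (\<pi> s \<zeta>))"
    from eventually_happens'[OF ultrafilters_not_bot[OF qu] eventually_inverse_product[OF G pq this(4)]]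
    obtain s where "\<forall>\<^sub>F t in q. t \<in> (*) s ` {r. \<epsilon> \<le> cmod (\<phi> (\<pi> r \<zeta>))}" by blast
    from in_uf_closure_ofD[OF q this] show False
      using K_beta_translate[OF lr canc _ *] by blast
  qed
qed

text \<open>A set \<open>A\<close> of large values in \<open>p\<close> would put s A into
  \<open>q\<close>, giving s A positive mean for some left-invariant mean. By cancellation
  \<open>A\<close> is the preimage of s A under translation by \<open>s\<close>, so it has the same
  mean, although it is null.\<close>

lemma plim_inverse_product_D_star:
  assumes canc: "cancellative TYPE('s)" and amen: "bi_amenable TYPE('s)"
    and G: "group_of_right_quotients \<iota> gm ge gi"
    and pq: "is_inverse_product \<iota> gm gi p q" and p: "p \<in> ultrafilters" and q: "q \<in> D_star"
  shows "plim p = Q"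
proof (rule plim_inverse_product[OF canc G pq p])
  show qu: "q \<in> ultrafilters"
    using q by (simp add: D_star_def)
  show "plim q \<in> min_ideal"
    by (rule plim_D_star[OF amen q])
  show "plim p \<in> min_ideal"
  proof (rule plim_min_idealI[OF p], rule notI)
    fix \<zeta> and \<phi> :: "'e \<Rightarrow> complex" and \<epsilon> :: real
    assume *: "Q \<zeta> = 0" "bounded_clinear \<phi>" "\<epsilon> > 0" and "\<forall>\<^sub>F s in p. \<epsilon> \<le> cmod (\<phi> (\<pi> s \<zeta>))"
    define A where "A = {r. \<epsilon> \<le> cmod (\<phi> (\<pi> r \<zeta>))}"
    obtain s where "\<forall>\<^sub>F t in q. t \<in> (*) s ` A"
      using eventually_happens'[OF ultrafilters_not_bot[OF qu]
          eventually_inverse_product[OF G pq \<open>\<forall>\<^sub>F s in p. \<epsilon> \<le> cmod (\<phi> (\<pi> s \<zeta>))\<close>]]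
      by (auto simp: A_def)
    from D_star_ex_mean[OF amen q this]
    obtain m where m: "left_invariant_mean m" "0 < Re (m (indicator ((*) s ` A)))" by blast
    have "{t. s * t \<in> (*) s ` A} = A"
      using injD[OF cancellative_inj[OF canc, of s]] by auto
    then have "0 < Re (m (indicator A))"
      using m(2) left_invariant_mean_vimage[OF m(1), of s "(*) s ` A"] by simp
    with left_invariant_mean_null[OF m(1) *] show False by (simp add: A_def)
  qed
qed

end

section \<open>Idempotents and products q^{-1} q: the four cases\<close>

theorem theorem5p2:
  fixes \<pi> :: "'s::semigroup_mult \<Rightarrow> 'e::complex_banach \<Rightarrow> 'e"
    and \<iota> :: "'s \<Rightarrow> 'g" and gm :: "'g \<Rightarrow> 'g \<Rightarrow> 'g" and ge :: 'g and gi :: "'g \<Rightarrow> 'g"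
  assumes "JdLG_admissible \<pi>"
  shows
    "(\<forall>p \<in> uf_topology closure_of K_beta. uf_mult (*) p p = p \<longrightarrow>
        limitin weak_operator_topology \<pi> (JdLG_projection \<pi>) p) \<and>
     (bi_amenable TYPE('s) \<longrightarrow>
       (\<forall>p \<in> D_star. uf_mult (*) p p = p \<longrightarrow>
         limitin weak_operator_topology \<pi> (JdLG_projection \<pi>) p)) \<and>
     (cancellative TYPE('s) \<and> left_reversible TYPE('s) \<and>
       group_of_right_quotients \<iota> gm ge gi \<longrightarrow>
       (\<forall>p \<in> ultrafilters. \<forall>q \<in> uf_topology closure_of K_beta. is_inverse_product \<iota> gm gi p q \<longrightarrow>
         limitin weak_operator_topology \<pi> (JdLG_projection \<pi>) p)) \<and>
     (cancellative TYPE('s) \<and> bi_amenable TYPE('s) \<and>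
       group_of_right_quotients \<iota> gm ge gi \<longrightarrow>
       (\<forall>p \<in> ultrafilters. \<forall>q \<in> D_star. is_inverse_product \<iota> gm gi p q \<longrightarrow>
         limitin weak_operator_topology \<pi> (JdLG_projection \<pi>) p))"
proof -
  interpret JdLG_representation \<pi>
    by standard (rule assms)
  have lim: "limitin weak_operator_topology \<pi> (JdLG_projection \<pi>) p"
    if "p \<in> ultrafilters" "plim p = Q" for p
    using limitin_plim[OF that(1)] by (simp add: that(2) JdLG_projection_eq)
  have uf: "p \<in> ultrafilters" if "p \<in> D_star" for p :: "'s filter"
    using that by (simp add: D_star_def)
  show ?thesis
  proof (intro conjI impI ballI, goal_cases)
    case (1 p)
    show ?case
      by (rule limitin_projection_if_idempotent[OF subsetD[OF uf_closure_of_subset_ultrafilters 1(1)]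
            plim_closure_K_beta[OF 1(1)] 1(2)])
  next
    case (2 p)
    show ?case
      by (rule limitin_projection_if_idempotent[OF uf[OF 2(2)] plim_D_star[OF 2(1,2)] 2(3)])
  next
    case (3 p q)
    then have h: "cancellative TYPE('s)" "left_reversible TYPE('s)" "group_of_right_quotients \<iota> gm ge gi"
      by auto
    show ?case
      by (rule lim[OF 3(2) plim_inverse_product_closure_K_beta[OF h 3(4,2,3)]])
  next
    case (4 p q)
    then have h: "cancellative TYPE('s)" "bi_amenable TYPE('s)" "group_of_right_quotients \<iota> gm ge gi"
      by auto
    show ?case
      by (rule lim[OF 4(2) plim_inverse_product_D_star[OF h 4(4,2,3)]])
  qed
qed

end
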